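(* Let $A$ be a Banach lattice algebra with identity $e$, and let $A_e$ be the order ideal generated by $e$, equipped with the norm $\|x\|_e=\inf\{\lambda>0:|x|\le\lambda e\}$. Then: (i) $(A_e,\|\cdot\|_e)$, with the order and product of $A$, is a Banach lattice algebra which is lattice and algebra isometric to $C(K)$ (real continuous functions, pointwise operations, sup norm) for some compact Hausdorff space $K$; (ii) $A_e$ is a principal projection band in $A$, i.e. it is a band and $A=A_e\oplus A_e^{d}$, where $A_e^d=\{x\in A: |x|\wedge|y|=0\ \forall y\in A_e\}$; (iii) $A_e$ is an inverse closed subalgebra of $A$: if $a\in A_e$ is invertible in $A$ then $a^{-1}\in A_e$.
   Context: A Banach lattice algebra is a real Banach lattice $A$ with an associative bilinear product making $(A,\cdot)$ a Banach algebra ($\|xy\|\le\|x\|\|y\|$) such that $xy\ge0$ whenever $x,y\ge0$. It has identity $e$ if $e$ is a multiplicative identity with $\|e\|=1$ (such $e$ is positive). $A_e=\{x\in A:|x|\le\lambda e\text{ for some }\lambda\ge0\}$. *)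

theory Defs
  imports "HOL-Analysis.Analysis"
begin

text \<open>The Banach lattice algebra A is modelled as a type 'a carrying a real Banach
algebra structure with unit 1 of norm 1 (class real_normed_algebra_1 + banach) and a
lattice order (class lattice), subject to the compatibility axioms below.\<close>

definition lat_abs :: "'a::{lattice,uminus} \<Rightarrow> 'a" where
  "lat_abs x = sup x (- x)"

definition banach_lattice_algebra :: "'a::{banach,real_normed_algebra_1,lattice} itself \<Rightarrow> bool" where
  "banach_lattice_algebra _ \<longleftrightarrow>
     (\<forall>x y z::'a. x \<le> y \<longrightarrow> x + z \<le> y + z) \<and>
     (\<forall>(x::'a) y (c::real). x \<le> y \<and> 0 \<le> c \<longrightarrow> c *\<^sub>R x \<le> c *\<^sub>R y) \<and>
     (\<forall>x y::'a. lat_abs x \<le> lat_abs y \<longrightarrow> norm x \<le> norm y) \<and>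
     (\<forall>x y::'a. 0 \<le> x \<and> 0 \<le> y \<longrightarrow> 0 \<le> x * y)"

definition Ae :: "'a::{real_normed_algebra_1,lattice} set" where
  "Ae = {x. \<exists>t::real. 0 \<le> t \<and> lat_abs x \<le> t *\<^sub>R 1}"

definition norm_e :: "'a::{real_normed_algebra_1,lattice} \<Rightarrow> real" where
  "norm_e x = Inf {t::real. 0 < t \<and> lat_abs x \<le> t *\<^sub>R 1}"

definition BLA_on :: "'a::{real_normed_algebra_1,lattice} set \<Rightarrow> ('a \<Rightarrow> real) \<Rightarrow> bool" where
  "BLA_on S N \<longleftrightarrow>
     0 \<in> S \<and> 1 \<in> S \<and>
     (\<forall>x\<in>S. \<forall>y\<in>S. x + y \<in> S \<and> x * y \<in> S \<and> sup x y \<in> S \<and> inf x y \<in> S) \<and>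
     (\<forall>x\<in>S. \<forall>c::real. c *\<^sub>R x \<in> S) \<and>
     (\<forall>x\<in>S. 0 \<le> N x \<and> (N x = 0 \<longleftrightarrow> x = 0)) \<and>
     (\<forall>x\<in>S. \<forall>c::real. N (c *\<^sub>R x) = \<bar>c\<bar> * N x) \<and>
     (\<forall>x\<in>S. \<forall>y\<in>S. N (x + y) \<le> N x + N y) \<and>
     (\<forall>x\<in>S. \<forall>y\<in>S. N (x * y) \<le> N x * N y) \<and>
     (\<forall>x\<in>S. \<forall>y\<in>S. lat_abs x \<le> lat_abs y \<longrightarrow> N x \<le> N y) \<and>
     N 1 = 1 \<and>
     (\<forall>f::nat \<Rightarrow> 'a. (\<forall>n. f n \<in> S) \<and>
         (\<forall>\<epsilon>>0. \<exists>M. \<forall>m\<ge>M. \<forall>n\<ge>M. N (f m - f n) < \<epsilon>) \<longrightarrow>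
         (\<exists>x\<in>S. \<forall>\<epsilon>>0. \<exists>M. \<forall>n\<ge>M. N (f n - x) < \<epsilon>))"

definition isometric_to_CK ::
  "'a::{real_normed_algebra_1,lattice} set \<Rightarrow> ('a \<Rightarrow> real) \<Rightarrow> 'k topology \<Rightarrow> ('a \<Rightarrow> 'k \<Rightarrow> real) \<Rightarrow> bool" where
  "isometric_to_CK S N X T \<longleftrightarrow>
     (\<forall>x\<in>S. continuous_map X euclideanreal (T x)) \<and>
     (\<forall>x\<in>S. \<forall>y\<in>S. \<forall>k\<in>topspace X. T (x + y) k = T x k + T y k) \<and>
     (\<forall>x\<in>S. \<forall>c::real. \<forall>k\<in>topspace X. T (c *\<^sub>R x) k = c * T x k) \<and>
     (\<forall>x\<in>S. \<forall>y\<in>S. \<forall>k\<in>topspace X. T (x * y) k = T x k * T y k) \<and>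
     (\<forall>x\<in>S. \<forall>y\<in>S. \<forall>k\<in>topspace X. T (sup x y) k = max (T x k) (T y k)) \<and>
     (\<forall>x\<in>S. \<forall>y\<in>S. \<forall>k\<in>topspace X. T (inf x y) k = min (T x k) (T y k)) \<and>
     (\<forall>k\<in>topspace X. T 1 k = 1) \<and>
     (\<forall>x\<in>S. N x = (SUP k\<in>topspace X. \<bar>T x k\<bar>)) \<and>
     (\<forall>f. continuous_map X euclideanreal f \<longrightarrow> (\<exists>x\<in>S. \<forall>k\<in>topspace X. T x k = f k))"

definition is_sup_of :: "'a::order set \<Rightarrow> 'a \<Rightarrow> bool" where
  "is_sup_of D s \<longleftrightarrow> (\<forall>d\<in>D. d \<le> s) \<and> (\<forall>u. (\<forall>d\<in>D. d \<le> u) \<longrightarrow> s \<le> u)"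

definition order_ideal :: "'a::{real_vector,lattice} set \<Rightarrow> bool" where
  "order_ideal B \<longleftrightarrow> 0 \<in> B \<and> (\<forall>x\<in>B. \<forall>y\<in>B. x + y \<in> B) \<and> (\<forall>x\<in>B. \<forall>c::real. c *\<^sub>R x \<in> B) \<and>
     (\<forall>x y. y \<in> B \<and> lat_abs x \<le> lat_abs y \<longrightarrow> x \<in> B)"

definition band :: "'a::{real_vector,lattice} set \<Rightarrow> bool" where
  "band B \<longleftrightarrow> order_ideal B \<and> (\<forall>D s. D \<subseteq> B \<and> is_sup_of D s \<longrightarrow> s \<in> B)"

definition disj_compl :: "'a::{real_vector,lattice} set \<Rightarrow> 'a set" where
  "disj_compl B = {x. \<forall>y\<in>B. inf (lat_abs x) (lat_abs y) = 0}"

end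

(*
  The identity is positive: with v = e^- one has |e| = e + 2v, so |e|^n >= e + 2nv while the norm
  of |e|^n is at most 1, which forces v = 0.

  The key point is that the norm of A and the norm ||.||_e agree on A_e.  If y >= 0 lies in A_e
  and ||y|| < 1, put f = (y - e)^+; the disjoint elements f and (e - y)^+ multiply to 0, so
  f = (y inf e) f and ||f|| <= ||y|| ||f||, hence f = 0 and y <= e.  Therefore A_e is closed and
  x inf (t e) <= ||x|| e for all t, so x inf (||x|| e) is the band component of x >= 0.

  If a in A_e has the inverse b = p + q with p in A_e and q disjoint from A_e, then
  a q = e - a p is both in A_e and disjoint from it, so a q = 0 and q = b a q = 0.

  K is the set of real lattice homomorphisms on A taking the value 1 at e, with the topology of
  pointwise convergence.  They are automatically multiplicative on A_e, because
  |phi(z y)| <= ||y|| |phi(z)|, and they vanish on the disjoint complement of A_e.  Enough of them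
  exist by Zorn's lemma: a minimal element among the sublinear functionals that turn sup into max
  is linear.  Surjectivity onto C(K) is the Stone-Weierstrass theorem and completeness.
*)

theory Submission
  imports Defs "HOL-Library.Lattice_Algebras"
begin

section \<open>Separation axioms for function types\<close>

text \<open>The arities for \<open>t0_space\<close> and \<open>t1_space\<close> have to come first, because the metric-space
  instance of the function type over countable domains has declared narrower ones.\<close>

instance "fun" :: (type, t0_space) t0_space
proof
  fix f g :: "'a \<Rightarrow> 'b"
  assume "f \<noteq> g"
  then obtain i where "f i \<noteq> g i" by blast
  then obtain U where U: "open U" "\<not> (f i \<in> U \<longleftrightarrow> g i \<in> U)"
    using separation_t0 by metis
  moreover have "open ((\<lambda>h :: 'a \<Rightarrow> 'b. h i) -` U)"
    using U by (intro open_vimage) auto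
  ultimately show "\<exists>U. open U \<and> \<not> (f \<in> U \<longleftrightarrow> g \<in> U)"
    by (intro exI[of _ "(\<lambda>h. h i) -` U"]) simp
qed

instance "fun" :: (type, t1_space) t1_space
proof
  fix f g :: "'a \<Rightarrow> 'b"
  assume "f \<noteq> g"
  then obtain i where "f i \<noteq> g i" by blast
  then obtain U where U: "open U" "f i \<in> U" "g i \<notin> U"
    using separation_t1 by metis
  moreover have "open ((\<lambda>h :: 'a \<Rightarrow> 'b. h i) -` U)"
    using U by (intro open_vimage) auto
  ultimately show "\<exists>U. open U \<and> f \<in> U \<and> g \<notin> U"
    by (intro exI[of _ "(\<lambda>h. h i) -` U"]) simp
qed

text \<open>\<open>Stone_Weierstrass_HOL\<close> is stated over a Hausdorff type; this instance lets
  it be applied to sets of functionals.\<close>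

instance "fun" :: (type, t2_space) t2_space
proof
  fix f g :: "'a \<Rightarrow> 'b"
  assume "f \<noteq> g"
  then obtain i where "f i \<noteq> g i" by blast
  then obtain U V where UV: "open U" "open V" "f i \<in> U" "g i \<in> V" "U \<inter> V = {}"
    using separation_t2 by metis
  moreover have "open ((\<lambda>h :: 'a \<Rightarrow> 'b. h i) -` U)" "open ((\<lambda>h :: 'a \<Rightarrow> 'b. h i) -` V)"
    using UV by (auto intro!: open_vimage)
  ultimately show "\<exists>U V. open U \<and> open V \<and> f \<in> U \<and> g \<in> V \<and> U \<inter> V = {}"
    by (intro exI[of _ "(\<lambda>h. h i) -` U"] exI[of _ "(\<lambda>h. h i) -` V"]) auto
qed

section \<open>Sublinear functionals that turn suprema into maxima\<close>

text \<open>The model is \<open>f \<mapsto> max\<^sub>F f\<close> on \<open>C(K)\<close> for a closed set \<open>F\<close>; the minimal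
  functionals of this kind are the point evaluations.\<close>

definition sup_sublinear :: "('a::{real_vector,lattice} \<Rightarrow> real) \<Rightarrow> bool" where
  "sup_sublinear p \<longleftrightarrow> (\<forall>x y. p (x + y) \<le> p x + p y) \<and>
     (\<forall>x c. 0 \<le> c \<longrightarrow> p (c *\<^sub>R x) \<le> c * p x) \<and>
     (\<forall>x y. p (sup x y) = max (p x) (p y))"

lemma sup_sublinear_add: "sup_sublinear p \<Longrightarrow> p (x + y) \<le> p x + p y"
  and sup_sublinear_scaleR_le: "sup_sublinear p \<Longrightarrow> 0 \<le> c \<Longrightarrow> p (c *\<^sub>R x) \<le> c * p x"
  and sup_sublinear_sup: "sup_sublinear p \<Longrightarrow> p (sup x y) = max (p x) (p y)"
  by (simp_all add: sup_sublinear_def)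

lemma sup_sublinear_0: "sup_sublinear p \<Longrightarrow> p 0 = 0"
  using sup_sublinear_add[of p 0 0] sup_sublinear_scaleR_le[of p 0 0] by simp

lemma sup_sublinear_minus_le: "sup_sublinear p \<Longrightarrow> - p (- x) \<le> p x"
  using sup_sublinear_add[of p x "- x"] sup_sublinear_0[of p] by simp

lemma sup_sublinear_scaleR:
  assumes "sup_sublinear p" "0 \<le> c"
  shows "p (c *\<^sub>R x) = c * p x"
proof (cases "c = 0")
  case False
  with assms have "0 < c" by simp
  then show ?thesis
    using sup_sublinear_scaleR_le[OF assms, of x]
      sup_sublinear_scaleR_le[OF assms(1), of "1 / c" "c *\<^sub>R x"]
    by (simp add: field_simps)
qed (use assms sup_sublinear_0 in simp)

text \<open>Subadditivity and homogeneity are demanded only up to passing to another member of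
  \<open>F\<close>. This covers chains as well as the one-parameter family in
  \<open>sup_sublinear_cut\<close>, whose members need not be subadditive one by one. Directedness
  provides a single member that is small at x and at y simultaneously.\<close>

lemma sup_sublinear_INF:
  fixes F :: "('a::{real_vector,lattice} \<Rightarrow> real) set"
  assumes ne: "F \<noteq> {}" and bdd: "\<And>x. bdd_below ((\<lambda>f. f x) ` F)"
    and add: "\<And>f g. f \<in> F \<Longrightarrow> g \<in> F \<Longrightarrow> \<exists>h\<in>F. \<forall>x y. h (x + y) \<le> f x + g y"
    and scale: "\<And>f c. f \<in> F \<Longrightarrow> 0 \<le> c \<Longrightarrow> \<exists>h\<in>F. \<forall>x. h (c *\<^sub>R x) \<le> c * f x"
    and dir: "\<And>f g. f \<in> F \<Longrightarrow> g \<in> F \<Longrightarrow> \<exists>h\<in>F. \<forall>x. h x \<le> f x \<and> h x \<le> g x"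
    and sup: "\<And>f x y. f \<in> F \<Longrightarrow> f (sup x y) = max (f x) (f y)"
  shows "sup_sublinear (\<lambda>x. INF f\<in>F. f x)"
proof -
  define q where "q x = (INF f\<in>F. f x)" for x
  have lower: "q x \<le> f x" if "f \<in> F" for f x
    unfolding q_def using that by (intro cINF_lower bdd)
  have greatest: "b \<le> q x" if "\<And>f. f \<in> F \<Longrightarrow> b \<le> f x" for b x
    unfolding q_def using that by (intro cINF_greatest ne)
  have approx: "\<exists>f\<in>F. f x < b" if "q x < b" for b x
    using that greatest[of b x] by (meson not_le)
  have "q (x + y) \<le> q x + q y" for x y
  proof -
    have "q (x + y) - f x \<le> g y" if fg: "f \<in> F" "g \<in> F" for f g
    proof -
      obtain h where "h \<in> F" "h (x + y) \<le> f x + g y" using add[OF fg] by blast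
      then show ?thesis using lower[of h "x + y"] by simp
    qed
    then have "q (x + y) - f x \<le> q y" if "f \<in> F" for f using that by (intro greatest)
    then have "q (x + y) - q y \<le> q x" by (intro greatest) (simp add: algebra_simps)
    then show ?thesis by simp
  qed
  moreover have "q (c *\<^sub>R x) \<le> c * q x" if c: "0 \<le> c" for x c
  proof -
    have le: "q (c *\<^sub>R x) \<le> c * f x" if "f \<in> F" for f
      using scale[OF that c] lower order_trans by blast
    show ?thesis
    proof (cases "c = 0")
      case True
      then show ?thesis using ne le by auto
    next
      case False
      with c have "q (c *\<^sub>R x) / c \<le> q x"
        using le by (intro greatest) (simp add: field_simps)
      with False c show ?thesis by (simp add: field_simps)
    qed
  qed
  moreover have "q (sup x y) = max (q x) (q y)" for x y
  proof (rule antisym)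
    show "max (q x) (q y) \<le> q (sup x y)"
    proof (rule greatest)
      fix f assume "f \<in> F"
      then show "max (q x) (q y) \<le> f (sup x y)"
        using lower by (simp only: sup max.mono)
    qed
    show "q (sup x y) \<le> max (q x) (q y)"
    proof (rule dense_ge)
      fix b assume "max (q x) (q y) < b"
      then obtain f g where fg: "f \<in> F" "g \<in> F" "f x < b" "g y < b"
        using approx[of x b] approx[of y b] by auto
      then obtain h where "h \<in> F" "h x \<le> f x" "h y \<le> g y" using dir[of f g] by blast
      then show "q (sup x y) \<le> b" using lower[of h "sup x y"] fg by (simp add: sup)
    qed
  qed
  ultimately show ?thesis by (simp add: sup_sublinear_def q_def)
qed

section \<open>Real-valued lattice homomorphisms\<close>

definition lattice_hom :: "('a::{real_vector,lattice} \<Rightarrow> real) \<Rightarrow> bool" where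
  "lattice_hom \<phi> \<longleftrightarrow> (\<forall>x y. \<phi> (x + y) = \<phi> x + \<phi> y) \<and> (\<forall>x c. \<phi> (c *\<^sub>R x) = c * \<phi> x) \<and>
     (\<forall>x y. \<phi> (sup x y) = max (\<phi> x) (\<phi> y))"

lemma lattice_hom_add: "lattice_hom \<phi> \<Longrightarrow> \<phi> (x + y) = \<phi> x + \<phi> y"
  and lattice_hom_scaleR: "lattice_hom \<phi> \<Longrightarrow> \<phi> (c *\<^sub>R x) = c * \<phi> x"
  and lattice_hom_sup: "lattice_hom \<phi> \<Longrightarrow> \<phi> (sup x y) = max (\<phi> x) (\<phi> y)"
  by (simp_all add: lattice_hom_def)

lemma lattice_hom_minus: "lattice_hom \<phi> \<Longrightarrow> \<phi> (- x) = - \<phi> x"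
  using lattice_hom_scaleR[of \<phi> "-1" x] by simp

lemma lattice_hom_diff: "lattice_hom \<phi> \<Longrightarrow> \<phi> (x - y) = \<phi> x - \<phi> y"
  using lattice_hom_add[of \<phi> x "- y"] lattice_hom_minus[of \<phi> y] by simp

lemma lattice_hom_mono: "lattice_hom \<phi> \<Longrightarrow> x \<le> y \<Longrightarrow> \<phi> x \<le> \<phi> y"
  using lattice_hom_sup[of \<phi> x y] by (simp add: sup.absorb2)

lemma lattice_hom_lat_abs: "lattice_hom \<phi> \<Longrightarrow> \<phi> (lat_abs x) = \<bar>\<phi> x\<bar>"
  by (simp add: lat_abs_def lattice_hom_sup lattice_hom_minus abs_if max_def)

section \<open>Order, modulus and norm in a Banach lattice algebra\<close>

locale unital_BLA =
  fixes A :: "'a::{banach,real_normed_algebra_1,lattice} itself"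
  assumes BLA: "banach_lattice_algebra A"
begin

text \<open>Compatibility of order and algebra is an assumption about the type and not a class
  constraint, so the facts on lattice-ordered rings come by interpretation and carry the prefix
  \<open>ord\<close>.\<close>

sublocale ord: lattice_ring lat_abs "(+)" "0 :: 'a" "(-)" uminus "(\<le>)" "(<)" inf sup "(*)"
proof
  fix a b c :: 'a
  have add: "x + z \<le> y + z" if "x \<le> y" for x y z :: 'a
    using BLA that unfolding banach_lattice_algebra_def by blast
  have mult: "0 \<le> x * y" if "0 \<le> x" "0 \<le> y" for x y :: 'a
    using BLA that unfolding banach_lattice_algebra_def by blast
  have diff: "0 \<le> y - x" if "x \<le> y" for x y :: 'a
    using add[OF that, of "- x"] by simp
  show "c + a \<le> c + b" if "a \<le> b"
    using add[OF that, of c] by (simp add: add.commute)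
  show "c * a \<le> c * b" if "a \<le> b" "0 \<le> c"
    using add[OF mult[OF that(2) diff[OF that(1)]], of "c * a"] by (simp add: algebra_simps)
  show "a * c \<le> b * c" if "a \<le> b" "0 \<le> c"
    using add[OF mult[OF diff[OF that(1)] that(2)], of "a * c"] by (simp add: algebra_simps)
  show "lat_abs a = sup a (- a)"
    by (simp add: lat_abs_def)
qed

sublocale ord: ordered_real_vector "(+)" "0 :: 'a" "(-)" uminus "(\<le>)" "(<)" scaleR
proof
  fix x y :: 'a and a b :: real
  show mono: "a *\<^sub>R x \<le> a *\<^sub>R y" if "x \<le> y" "0 \<le> a" for x y :: 'a and a :: real
    using BLA that unfolding banach_lattice_algebra_def by blast
  show "a *\<^sub>R x \<le> b *\<^sub>R x" if "a \<le> b" "0 \<le> x"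
    using mono[OF that(2), of "b - a"] that(1) by (simp add: scaleR_diff_left)
qed

lemma norm_le_of_lat_abs_le: "lat_abs x \<le> lat_abs y \<Longrightarrow> norm (x :: 'a) \<le> norm y"
  using BLA unfolding banach_lattice_algebra_def by simp

lemma norm_lat_abs [simp]: "norm (lat_abs x) = norm (x :: 'a)"
  by (intro antisym norm_le_of_lat_abs_le) (simp_all only: ord.abs_idempotent order_refl)

lemma norm_mono: "0 \<le> x \<Longrightarrow> x \<le> y \<Longrightarrow> norm (x :: 'a) \<le> norm y"
  using norm_le_of_lat_abs_le[of x y] by (metis ord.abs_of_nonneg order_trans)

lemma scaleR_nonneg: "0 \<le> c \<Longrightarrow> 0 \<le> x \<Longrightarrow> 0 \<le> c *\<^sub>R (x :: 'a)"
  using ord.scaleR_left_mono[of 0 x c] by simp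

text \<open>Scaling by c > 0 is monotone with the monotone inverse scaling by 1/c, hence it
  preserves suprema.\<close>

lemma scaleR_sup: "0 \<le> c \<Longrightarrow> c *\<^sub>R sup x y = sup (c *\<^sub>R x) (c *\<^sub>R (y :: 'a))"
proof (cases "c = 0")
  case False
  assume "0 \<le> c"
  with False have c: "0 < c" by simp
  have le: "sup (d *\<^sub>R u) (d *\<^sub>R v) \<le> d *\<^sub>R sup u v" if "0 < d" for d and u v :: 'a
    using that by (simp add: ord.scaleR_left_mono)
  have "c *\<^sub>R sup ((1/c) *\<^sub>R c *\<^sub>R x) ((1/c) *\<^sub>R c *\<^sub>R y) \<le> sup (c *\<^sub>R x) (c *\<^sub>R y)"
    using ord.scaleR_left_mono[OF le[of "1/c" "c *\<^sub>R x" "c *\<^sub>R y"], of c] c by simp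
  with le[OF c, of x y] c show ?thesis by (simp add: antisym)
qed simp

lemma scaleR_inf: "0 \<le> c \<Longrightarrow> c *\<^sub>R inf x y = inf (c *\<^sub>R x) (c *\<^sub>R (y :: 'a))"
  using scaleR_sup[of c "- x" "- y"] by (simp only: ord.inf_eq_neg_sup scaleR_minus_right)

lemma lat_abs_scaleR: "lat_abs (c *\<^sub>R x) = \<bar>c\<bar> *\<^sub>R lat_abs (x :: 'a)"
proof (cases "0 \<le> c")
  case True
  then show ?thesis by (simp add: lat_abs_def scaleR_sup)
next
  case False
  then show ?thesis using scaleR_sup[of "-c" x "-x"] by (simp add: lat_abs_def sup_commute)
qed

text \<open>Twice |a||b| - ab, and likewise twice |a||b| + ab, is a sum of products of the positive
  elements |a| - a, |a| + a, |b| - b, |b| + b.\<close>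

lemma lat_abs_mult_le: "lat_abs (a * b) \<le> lat_abs a * lat_abs (b :: 'a)"
proof -
  let ?a = "lat_abs a" and ?b = "lat_abs b"
  have minus: "0 \<le> lat_abs x - x" and plus: "0 \<le> lat_abs x + x" for x :: 'a
    using ord.diff_ge_0_iff_ge[of "lat_abs x" x] ord.diff_ge_0_iff_ge[of "lat_abs x" "- x"]
      ord.abs_ge_self[of x] ord.abs_ge_minus_self[of x] by simp_all
  have "0 \<le> (?a - a) * (?b + b) + (?a + a) * (?b - b)"
    by (intro ord.add_nonneg_nonneg ord.mult_nonneg_nonneg minus plus)
  also have "\<dots> = (?a * ?b - a * b) + (?a * ?b - a * b)"
    by (simp add: algebra_simps)
  finally have 1: "a * b \<le> ?a * ?b"
    by (simp add: ord.diff_ge_0_iff_ge)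
  have "0 \<le> (?a + a) * (?b + b) + (?a - a) * (?b - b)"
    by (intro ord.add_nonneg_nonneg ord.mult_nonneg_nonneg minus plus)
  also have "\<dots> = (?a * ?b + a * b) + (?a * ?b + a * b)"
    by (simp add: algebra_simps)
  finally have 2: "- (a * b) \<le> ?a * ?b"
    using ord.diff_ge_0_iff_ge[of "?a * ?b" "- (a * b)"] by simp
  from 1 2 show ?thesis by (rule ord.abs_leI)
qed

lemma continuous_lat_abs: "continuous_on UNIV (lat_abs :: 'a \<Rightarrow> 'a)"
proof -
  have "dist (lat_abs x) (lat_abs y) \<le> dist x y" for x y :: 'a
    unfolding dist_norm by (intro norm_le_of_lat_abs_le ord.abs_triangle_ineq3)
  then show ?thesis
    unfolding continuous_on_iff by (meson le_less_trans)
qed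

text \<open>The positive cone is the set of fixed points of the continuous map
  \<open>lat_abs\<close>.\<close>

lemma closed_nonneg: "closed {x :: 'a. 0 \<le> x}"
proof -
  have "{x :: 'a. 0 \<le> x} = {x. lat_abs x = x}"
    by (metis ord.abs_ge_zero ord.abs_of_nonneg)
  then show ?thesis
    using continuous_lat_abs by (simp add: closed_Collect_eq continuous_on_id)
qed

lemma closed_le:
  fixes f g :: "'b::topological_space \<Rightarrow> 'a"
  assumes "continuous_on UNIV f" "continuous_on UNIV g"
  shows "closed {x. f x \<le> g x}"
proof -
  have "{x. f x \<le> g x} = (\<lambda>x. g x - f x) -` {x. 0 \<le> x}"
    by (simp add: vimage_def ord.diff_ge_0_iff_ge)
  then show ?thesis
    using closed_vimage[OF closed_nonneg continuous_on_diff[OF assms(2,1)]] by metis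
qed

section \<open>Positivity of the identity\<close>

lemma one_nonneg: "0 \<le> (1 :: 'a)"
proof -
  define v where "v = sup (- 1) (0 :: 'a)"
  have v: "0 \<le> v" unfolding v_def by (rule sup.cobounded2)
  \<comment> \<open>Here v is the negative part of e: doubling it gives sup (-2e) 0, and adding e
    turns this into sup (-e) e.\<close>
  have abs1: "lat_abs (1 :: 'a) = 1 + (v + v)"
  proof -
    have "v + v = sup (- 1 - 1) 0"
      using scaleR_sup[of 2 "- 1" "0 :: 'a"] by (simp add: v_def scaleR_2)
    then show ?thesis
      by (simp add: ord.add_sup_distrib_left lat_abs_def sup_commute)
  qed
  \<comment> \<open>Bernoulli: \<open>|e|\<^sup>n = (e + 2v)\<^sup>n\<close> is norm bounded, so \<open>n v\<close> is too.\<close>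
  have bern: "1 + real n *\<^sub>R (v + v) \<le> lat_abs (1 :: 'a) ^ n" for n
  proof (induction n)
    case (Suc n)
    have "0 \<le> lat_abs (1 :: 'a)" by simp
    then have "lat_abs 1 * (1 + real n *\<^sub>R (v + v)) \<le> lat_abs 1 * lat_abs 1 ^ n"
      by (intro ord.mult_left_mono Suc)
    moreover have "lat_abs 1 * (1 + real n *\<^sub>R (v + v))
        = 1 + real (Suc n) *\<^sub>R (v + v) + real n *\<^sub>R ((v + v) * (v + v))"
      unfolding abs1 by (simp add: algebra_simps)
    moreover have "0 \<le> real n *\<^sub>R ((v + v) * (v + v))"
      by (intro scaleR_nonneg ord.mult_nonneg_nonneg ord.add_nonneg_nonneg v) simp
    ultimately show ?case
      by (metis ord.le_add_same_cancel1 order_trans power_Suc)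
  qed simp
  have bound: "real n * norm (v + v) \<le> 2" for n
  proof -
    have "real n *\<^sub>R (v + v) \<le> lat_abs 1 ^ n - 1"
      using bern[of n] by (simp only: ord.le_diff_eq add.commute)
    moreover have "0 \<le> real n *\<^sub>R (v + v)"
      by (intro scaleR_nonneg ord.add_nonneg_nonneg v) simp
    ultimately have "norm (real n *\<^sub>R (v + v)) \<le> norm (lat_abs (1 :: 'a) ^ n - 1)"
      by (intro norm_mono)
    also have "\<dots> \<le> norm (lat_abs (1 :: 'a) ^ n) + norm (1 :: 'a)"
      by (rule norm_triangle_ineq4)
    also have "\<dots> \<le> 2"
      using norm_power_ineq[of "lat_abs (1 :: 'a)" n] by simp
    finally show ?thesis by simp
  qed
  have "norm (v + v) = 0"
  proof (rule ccontr)
    assume "norm (v + v) \<noteq> 0"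
    then have "0 < norm (v + v)" by simp
    then obtain n where "2 < real n * norm (v + v)"
      using reals_Archimedean3 by blast
    with bound[of n] show False by simp
  qed
  then have "v = 0" using ord.double_zero[of v] by simp
  then have "- 1 \<le> (0 :: 'a)" by (metis sup.cobounded1 v_def)
  then show ?thesis by (simp only: ord.neg_le_0_iff_le)
qed

lemma scaleR_one_le_iff [simp]: "s *\<^sub>R 1 \<le> t *\<^sub>R (1 :: 'a) \<longleftrightarrow> s \<le> t"
proof
  assume le: "s *\<^sub>R 1 \<le> t *\<^sub>R (1 :: 'a)"
  show "s \<le> t"
  proof (rule ccontr)
    assume "\<not> s \<le> t"
    then have "t *\<^sub>R 1 \<le> s *\<^sub>R (1 :: 'a)"
      by (intro ord.scaleR_right_mono one_nonneg) simp
    with le have "t *\<^sub>R 1 = s *\<^sub>R (1 :: 'a)" by (rule antisym[rotated])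
    with \<open>\<not> s \<le> t\<close> show False by simp
  qed
qed (intro ord.scaleR_right_mono one_nonneg)

lemma scaleR_one_ge_0_iff [simp]: "0 \<le> t *\<^sub>R (1 :: 'a) \<longleftrightarrow> 0 \<le> t"
  using scaleR_one_le_iff[of 0 t] by (simp only: scaleR_zero_left)

lemma scaleR_one_le_0_iff [simp]: "t *\<^sub>R (1 :: 'a) \<le> 0 \<longleftrightarrow> t \<le> 0"
  using scaleR_one_le_iff[of t 0] by (simp only: scaleR_zero_left)

section \<open>Calculus of disjoint elements\<close>

lemma inf_scaleR_eq_0:
  fixes x y :: 'a
  assumes "inf x y = 0" "0 \<le> c" "0 \<le> d"
  shows "inf (c *\<^sub>R x) (d *\<^sub>R y) = 0"
proof -
  have x: "0 \<le> x" and y: "0 \<le> y" using assms(1) by (metis inf.cobounded1 inf.cobounded2)+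
  \<comment> \<open>A common scalar reduces the claim to homogeneity of the infimum.\<close>
  define m where "m = max c d"
  have "inf (c *\<^sub>R x) (d *\<^sub>R y) \<le> inf (m *\<^sub>R x) (m *\<^sub>R y)"
    by (intro inf_mono ord.scaleR_right_mono x y) (simp_all add: m_def)
  also have "\<dots> = m *\<^sub>R inf x y"
    using scaleR_inf[of m x y] assms by (simp add: m_def)
  finally show ?thesis
    using assms x y by (intro antisym le_infI scaleR_nonneg) simp_all
qed

lemma inf_eq_0_mono:
  fixes x y :: 'a
  assumes "inf x y = 0" "0 \<le> x'" "x' \<le> x" "0 \<le> y'" "y' \<le> y"
  shows "inf x' y' = 0"
  using inf_mono[OF assms(3,5)] assms by (intro antisym le_infI) simp_all

text \<open>If w is below x + y and z, then w - x is below y and, since x is positive, below z;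
  hence w \<le> x, and w lies below both x and z. The form with inequalities serves the one-sided
  estimates behind \<open>top_value\<close>.\<close>

lemma inf_add_le_0:
  fixes x y z :: 'a
  assumes "inf x z \<le> 0" "inf y z \<le> 0" "0 \<le> x"
  shows "inf (x + y) z \<le> 0"
proof -
  define w where "w = inf (x + y) z"
  have w: "w \<le> x + y" "w \<le> z" by (simp_all add: w_def)
  have "w - x \<le> y"
    using w(1) by (simp only: ord.diff_le_eq add.commute)
  moreover have "w - x \<le> z"
    using w(2) assms(3) by (meson ord.diff_le_eq ord.add_increasing2 order_trans)
  ultimately have "w - x \<le> 0" using assms(2) by (meson le_infI order_trans)
  then have "w \<le> x" by (simp only: ord.diff_le_0_iff_le)
  with w(2) show ?thesis unfolding w_def[symmetric] using assms(1) by (meson le_infI order_trans)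
qed

lemma inf_add_eq_0:
  fixes x y z :: 'a
  assumes "inf x z = 0" "inf y z = 0"
  shows "inf (x + y) z = 0"
proof (rule antisym)
  have "0 \<le> x" "0 \<le> y" "0 \<le> z" using assms by (metis inf.cobounded1 inf.cobounded2)+
  then show "0 \<le> inf (x + y) z" by (intro le_infI ord.add_nonneg_nonneg)
  show "inf (x + y) z \<le> 0" using assms \<open>0 \<le> x\<close> by (intro inf_add_le_0) simp_all
qed

section \<open>The ideal A_e as a sublattice and subalgebra\<close>

lemma AeI: "lat_abs x \<le> t *\<^sub>R 1 \<Longrightarrow> (x :: 'a) \<in> Ae"
  unfolding Ae_def using scaleR_one_ge_0_iff[of t] ord.abs_ge_zero[of x] order_trans by blast

lemma Ae_nonnegI: "0 \<le> x \<Longrightarrow> x \<le> t *\<^sub>R 1 \<Longrightarrow> (x :: 'a) \<in> Ae"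
  by (rule AeI) (simp only: ord.abs_of_nonneg)

lemma AeE:
  assumes "(x :: 'a) \<in> Ae"
  obtains t where "0 \<le> t" "lat_abs x \<le> t *\<^sub>R 1"
  using assms unfolding Ae_def by blast

lemma Ae_solid: "y \<in> Ae \<Longrightarrow> lat_abs x \<le> lat_abs y \<Longrightarrow> (x :: 'a) \<in> Ae"
  by (metis AeE AeI order_trans)

lemma zero_in_Ae [simp]: "(0 :: 'a) \<in> Ae"
  by (rule Ae_nonnegI[of _ 0]) simp_all

lemma one_in_Ae [simp]: "(1 :: 'a) \<in> Ae"
  by (rule Ae_nonnegI[of _ 1]) (simp_all add: one_nonneg)

lemma lat_abs_in_Ae: "(x :: 'a) \<in> Ae \<Longrightarrow> lat_abs x \<in> Ae"
  by (rule Ae_solid[of x]) (simp_all only: ord.abs_idempotent order_refl)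

lemma Ae_add:
  assumes "x \<in> Ae" "y \<in> Ae" shows "(x + y :: 'a) \<in> Ae"
proof -
  obtain s t where "lat_abs x \<le> s *\<^sub>R 1" "lat_abs y \<le> t *\<^sub>R 1" using assms by (metis AeE)
  then have "lat_abs x + lat_abs y \<le> (s + t) *\<^sub>R 1"
    unfolding scaleR_add_left by (rule ord.add_mono)
  then show ?thesis by (intro AeI[of _ "s + t"]) (rule order_trans[OF ord.abs_triangle_ineq])
qed

lemma Ae_mult:
  assumes "x \<in> Ae" "y \<in> Ae" shows "(x * y :: 'a) \<in> Ae"
proof -
  obtain s t where st: "0 \<le> s" "lat_abs x \<le> s *\<^sub>R 1" "lat_abs y \<le> t *\<^sub>R 1"
    using assms by (metis AeE)
  have "lat_abs x * lat_abs y \<le> s *\<^sub>R 1 * t *\<^sub>R 1"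
    by (rule ord.mult_mono[OF st(2,3)]) (simp_all add: st)
  also have "\<dots> = (s * t) *\<^sub>R 1" by simp
  finally show ?thesis by (intro AeI[of _ "s * t"]) (rule order_trans[OF lat_abs_mult_le])
qed

lemma Ae_scaleR: "(x :: 'a) \<in> Ae \<Longrightarrow> c *\<^sub>R x \<in> Ae"
proof (elim AeE)
  fix t assume "lat_abs x \<le> t *\<^sub>R 1"
  then have "lat_abs (c *\<^sub>R x) \<le> (\<bar>c\<bar> * t) *\<^sub>R 1"
    using ord.scaleR_left_mono[of "lat_abs x" "t *\<^sub>R 1" "\<bar>c\<bar>"] by (simp add: lat_abs_scaleR)
  then show ?thesis by (rule AeI)
qed

lemma Ae_minus: "(x :: 'a) \<in> Ae \<Longrightarrow> - x \<in> Ae"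
  using Ae_scaleR[of x "-1"] by simp

lemma Ae_diff: "x \<in> Ae \<Longrightarrow> y \<in> Ae \<Longrightarrow> (x - y :: 'a) \<in> Ae"
  using Ae_add[of x "- y"] Ae_minus by simp

lemma lat_abs_sup_le: "lat_abs (sup x y) \<le> lat_abs x + lat_abs (y :: 'a)"
proof (rule ord.abs_leI)
  have "x \<le> lat_abs x + lat_abs y" "y \<le> lat_abs x + lat_abs y"
    by (meson ord.abs_ge_self ord.abs_ge_zero ord.add_increasing ord.add_increasing2)+
  then show "sup x y \<le> lat_abs x + lat_abs y" by (rule le_supI)
  have "- sup x y \<le> - x" by (simp only: ord.neg_le_iff_le sup.cobounded1)
  also have "- x \<le> lat_abs x + lat_abs y"
    by (meson ord.abs_ge_minus_self ord.abs_ge_zero ord.add_increasing2)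
  finally show "- sup x y \<le> lat_abs x + lat_abs y" .
qed

lemma Ae_sup: "x \<in> Ae \<Longrightarrow> y \<in> Ae \<Longrightarrow> (sup x y :: 'a) \<in> Ae"
  by (rule Ae_solid[of "lat_abs x + lat_abs y"])
    (use lat_abs_sup_le[of x y] in \<open>auto intro: Ae_add lat_abs_in_Ae order_trans[OF _ ord.abs_ge_self]\<close>)

lemma Ae_inf: "x \<in> Ae \<Longrightarrow> y \<in> Ae \<Longrightarrow> (inf x y :: 'a) \<in> Ae"
  by (simp only: ord.inf_eq_neg_sup Ae_minus Ae_sup)

lemma order_ideal_Ae: "order_ideal (Ae :: 'a set)"
  unfolding order_ideal_def using Ae_add Ae_scaleR Ae_solid by auto

section \<open>Agreement of the two norms on A_e\<close>

lemma le_one_of_norm_less_one: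
  fixes y :: 'a
  assumes "0 \<le> y" "y \<in> Ae" "norm y < 1"
  shows "y \<le> 1"
proof -
  define f where "f = y - inf y 1"
  define g where "g = 1 - inf y 1"
  have f0: "0 \<le> f" and g0: "0 \<le> g"
    unfolding f_def g_def ord.diff_ge_0_iff_ge by (rule inf.cobounded1, rule inf.cobounded2)
  have m0: "0 \<le> inf y 1" using assms one_nonneg by simp
  have "inf f g = inf y 1 - inf y 1"
    unfolding f_def g_def diff_conv_add_uminus ord.add_inf_distrib_right ..
  then have fg: "inf f g = 0" by simp
  \<comment> \<open>Membership in A_e enters here: f \<le> c e and g \<le> e put g f below both c g
    and f, which are disjoint.\<close>
  obtain c where c: "0 \<le> c" "y \<le> c *\<^sub>R 1"
    using assms(1,2) by (metis AeE ord.abs_of_nonneg)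
  have "f \<le> y" using m0 by (simp only: f_def ord.diff_le_eq ord.le_add_same_cancel1)
  with c have fc: "f \<le> c *\<^sub>R 1" by (meson order_trans)
  have "g \<le> 1" using m0 by (simp only: g_def ord.diff_le_eq ord.le_add_same_cancel1)
  then have "g * f \<le> f" using ord.mult_right_mono[of g 1 f] f0 by simp
  moreover have "g * f \<le> c *\<^sub>R g" using ord.mult_left_mono[OF fc g0] by simp
  moreover have "0 \<le> g * f" using f0 g0 by (rule ord.mult_nonneg_nonneg[rotated])
  moreover have "inf f (c *\<^sub>R g) = 0"
    using inf_scaleR_eq_0[OF fg, of 1 c] c by simp
  ultimately have "g * f = 0" by (metis antisym le_inf_iff)
  \<comment> \<open>\<open>y \<and> e\<close> is a multiplicative unit for \<open>f\<close> whose norm is too small.\<close>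
  then have "f = inf y 1 * f" by (simp only: g_def left_diff_distrib mult_1_left right_minus_eq)
  then have "norm f \<le> norm (inf y 1) * norm f" by (metis norm_mult_ineq)
  moreover have "norm (inf y 1) < 1"
    using norm_mono[OF m0, of y] assms(3) by simp
  ultimately have "norm f = 0"
    by (smt (verit) mult_le_cancel_right1 norm_ge_zero)
  then have "y = inf y 1" by (simp only: f_def norm_eq_zero right_minus_eq)
  then show ?thesis by (metis inf.cobounded2)
qed

text \<open>The scalars s with x \<le> s e form a closed set, because the cone is closed.\<close>

lemma le_of_le_add_eps:
  fixes x :: 'a
  assumes "\<And>\<epsilon>. 0 < \<epsilon> \<Longrightarrow> x \<le> (r + \<epsilon>) *\<^sub>R 1"
  shows "x \<le> r *\<^sub>R 1"
proof -
  have "(\<lambda>n. r + 1 / real (Suc n)) \<longlonglongrightarrow> r + 0"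
    by (intro tendsto_intros LIMSEQ_Suc lim_const_over_n)
  moreover have "closed {s :: real. x \<le> s *\<^sub>R 1}"
    by (intro closed_le continuous_intros)
  ultimately show ?thesis
    using closed_sequentially[of "{s. x \<le> s *\<^sub>R 1}" "\<lambda>n. r + 1 / real (Suc n)" r] assms by simp
qed

text \<open>Dividing by r slightly above the norm reduces this to
  \<open>le_one_of_norm_less_one\<close>; the slack is then removed by closedness.\<close>

lemma lat_abs_le_norm:
  fixes x :: 'a
  assumes "x \<in> Ae"
  shows "lat_abs x \<le> norm x *\<^sub>R 1"
proof (rule le_of_le_add_eps)
  fix \<epsilon> :: real assume "0 < \<epsilon>"
  define r where "r = norm x + \<epsilon>"
  have r: "0 < r" "norm x < r" using \<open>0 < \<epsilon>\<close> by (simp_all add: r_def add_nonneg_pos)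
  define y where "y = inverse r *\<^sub>R lat_abs x"
  have "y \<le> 1"
  proof (rule le_one_of_norm_less_one)
    show "0 \<le> y" unfolding y_def using r by (intro scaleR_nonneg ord.abs_ge_zero) simp
    show "y \<in> Ae" unfolding y_def by (intro Ae_scaleR lat_abs_in_Ae assms)
    show "norm y < 1" using r by (simp add: y_def field_simps)
  qed
  from ord.scaleR_left_mono[OF this, of r] r show "lat_abs x \<le> (norm x + \<epsilon>) *\<^sub>R 1"
    by (simp add: y_def flip: r_def)
qed

lemma norm_le_of_lat_abs_le_scaleR: "lat_abs x \<le> t *\<^sub>R 1 \<Longrightarrow> norm (x :: 'a) \<le> t"
  using norm_mono[of "lat_abs x" "t *\<^sub>R 1"] ord.abs_ge_zero[of x] scaleR_one_ge_0_iff[of t]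
  by (metis abs_of_nonneg mult.right_neutral norm_lat_abs norm_one norm_scaleR order_trans)

lemma norm_e_eq_norm:
  fixes x :: 'a
  assumes "x \<in> Ae"
  shows "norm_e x = norm x"
  unfolding norm_e_def
proof (rule cInf_eq_non_empty)
  \<comment> \<open>The infimum runs over t > 0 only, so norm x itself is not admissible when x = 0;
    norm x + 1 always is.\<close>
  show "{t. 0 < t \<and> lat_abs x \<le> t *\<^sub>R 1} \<noteq> {}"
    using lat_abs_le_norm[OF assms] order_trans[of "lat_abs x" "norm x *\<^sub>R 1" "(norm x + 1) *\<^sub>R 1"]
    by (auto intro!: exI[of _ "norm x + 1"] simp: add_nonneg_pos)
  show "norm x \<le> t" if "t \<in> {t. 0 < t \<and> lat_abs x \<le> t *\<^sub>R 1}" for t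
    using that norm_le_of_lat_abs_le_scaleR by simp
  show "b \<le> norm x" if b: "\<And>t. t \<in> {t. 0 < t \<and> lat_abs x \<le> t *\<^sub>R 1} \<Longrightarrow> b \<le> t" for b
  proof (rule field_le_epsilon)
    fix \<epsilon> :: real assume "0 < \<epsilon>"
    then show "b \<le> norm x + \<epsilon>"
      using lat_abs_le_norm[OF assms]
        order_trans[of "lat_abs x" "norm x *\<^sub>R 1" "(norm x + \<epsilon>) *\<^sub>R 1"]
      by (intro b) (simp add: add_nonneg_pos)
  qed
qed

text \<open>By \<open>lat_abs_le_norm\<close>, A_e is cut out by the single closed condition |x|
  \<le> ||x|| e.\<close>

lemma closed_Ae: "closed (Ae :: 'a set)"
proof -
  have "(Ae :: 'a set) = {x. lat_abs x \<le> norm x *\<^sub>R 1}"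
    using lat_abs_le_norm AeI by blast
  moreover have "closed {x :: 'a. lat_abs x \<le> norm x *\<^sub>R 1}"
    by (intro closed_le continuous_lat_abs continuous_intros)
  ultimately show ?thesis by simp
qed

text \<open>As both norms coincide on A_e, the norm axioms are inherited from A, and completeness
  follows from closedness in A.\<close>

lemma BLA_on_Ae: "BLA_on (Ae :: 'a set) norm_e"
proof -
  have complete: "\<exists>x\<in>Ae. \<forall>\<epsilon>>0. \<exists>M. \<forall>n\<ge>M. norm_e (f n - x) < \<epsilon>"
    if f: "\<And>n. f n \<in> Ae" and C: "\<forall>\<epsilon>>0. \<exists>M. \<forall>m\<ge>M. \<forall>n\<ge>M. norm_e (f m - f n) < \<epsilon>"
    for f :: "nat \<Rightarrow> 'a"
  proof -
    have "Cauchy f"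
      using C f by (simp add: norm_e_eq_norm Ae_diff Cauchy_def dist_norm)
    then obtain x where x: "f \<longlonglongrightarrow> x" by (metis Cauchy_convergent_iff convergent_def)
    then have "x \<in> Ae" using f closed_Ae by (metis closed_sequentially)
    with x show ?thesis
      using f by (auto simp: norm_e_eq_norm Ae_diff LIMSEQ_iff)
  qed
  show ?thesis
    unfolding BLA_on_def using complete
    by (auto simp: norm_e_eq_norm Ae_add Ae_mult Ae_sup Ae_inf Ae_scaleR norm_triangle_ineq
        norm_mult_ineq norm_le_of_lat_abs_le)
qed

section \<open>The band decomposition of A\<close>

lemma inf_scaleR_one_le_norm:
  fixes x :: 'a
  assumes "0 \<le> t"
  shows "inf x (t *\<^sub>R 1) \<le> norm x *\<^sub>R 1"
proof -
  \<comment> \<open>The truncation of |x| lies in A_e, so it is dominated by its norm times e, and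
    that norm is at most ||x|| whatever t is.\<close>
  let ?y = "inf (lat_abs x) (t *\<^sub>R 1)"
  have y: "0 \<le> ?y" using assms by (intro le_infI) simp_all
  have "inf x (t *\<^sub>R 1) \<le> ?y" by (intro inf_mono ord.abs_ge_self order_refl)
  also have "\<dots> \<le> lat_abs ?y" by (rule ord.abs_ge_self)
  also have "\<dots> \<le> norm ?y *\<^sub>R 1"
    by (intro lat_abs_le_norm Ae_nonnegI[of _ t] y inf.cobounded2)
  also have "\<dots> \<le> norm x *\<^sub>R 1"
    using norm_mono[OF y inf.cobounded1] by simp
  finally show ?thesis .
qed

text \<open>Disjointness from e suffices, because every modulus in A_e lies below a multiple of
  e.\<close>

lemma mem_disj_compl_Ae_iff: "(x :: 'a) \<in> disj_compl Ae \<longleftrightarrow> inf (lat_abs x) 1 = 0"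
proof
  assume "x \<in> disj_compl Ae"
  then have "inf (lat_abs x) (lat_abs 1) = 0"
    unfolding disj_compl_def using one_in_Ae by blast
  then show "inf (lat_abs x) 1 = 0" by (simp only: ord.abs_of_nonneg one_nonneg)
next
  assume x: "inf (lat_abs x) 1 = 0"
  have "inf (lat_abs x) (lat_abs y) = 0" if "y \<in> Ae" for y
  proof -
    from that obtain t where t: "0 \<le> t" "lat_abs y \<le> t *\<^sub>R 1" by (rule AeE)
    show ?thesis
      using inf_scaleR_eq_0[OF x zero_le_one t(1)] t(2)
      by (simp add: inf_eq_0_mono[of "lat_abs x" "t *\<^sub>R 1"])
  qed
  then show "x \<in> disj_compl Ae" by (simp add: disj_compl_def)
qed

lemma disj_compl_Ae_minus: "(x :: 'a) \<in> disj_compl Ae \<Longrightarrow> - x \<in> disj_compl Ae"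
  by (simp only: mem_disj_compl_Ae_iff ord.abs_minus_cancel)

lemma disj_compl_Ae_add:
  "x \<in> disj_compl Ae \<Longrightarrow> y \<in> disj_compl Ae \<Longrightarrow> (x + y :: 'a) \<in> disj_compl Ae"
  unfolding mem_disj_compl_Ae_iff
  by (rule inf_eq_0_mono[of "lat_abs x + lat_abs y" 1])
    (simp_all only: one_nonneg inf_add_eq_0 ord.abs_triangle_ineq ord.abs_ge_zero order_refl)

lemma disj_compl_Ae_diff:
  "x \<in> disj_compl Ae \<Longrightarrow> y \<in> disj_compl Ae \<Longrightarrow> (x - y :: 'a) \<in> disj_compl Ae"
  using disj_compl_Ae_add[of x "- y"] by (simp only: disj_compl_Ae_minus add_uminus_conv_diff)

lemma le_0_of_disjoint_bounds:
  fixes w :: 'a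
  assumes "z \<in> Ae" "q \<in> disj_compl Ae" "w \<le> lat_abs z" "w \<le> lat_abs q"
  shows "w \<le> 0"
proof -
  have "w \<le> inf (lat_abs q) (lat_abs z)" using assms by simp
  also have "\<dots> = 0" using assms by (simp add: disj_compl_def)
  finally show ?thesis .
qed

lemma Ae_Int_disj_compl: "x \<in> Ae \<Longrightarrow> (x :: 'a) \<in> disj_compl Ae \<Longrightarrow> x = 0"
  using le_0_of_disjoint_bounds[of x x "lat_abs x"] by (simp only: order_refl ord.abs_le_zero_iff)

lemma Ae_decomposition_nonneg:
  fixes x :: 'a
  assumes "0 \<le> x"
  shows "inf x (norm x *\<^sub>R 1) \<in> Ae" and "x - inf x (norm x *\<^sub>R 1) \<in> disj_compl Ae"
proof -
  define p where "p = inf x (norm x *\<^sub>R 1)"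
  show "inf x (norm x *\<^sub>R 1) \<in> Ae"
    using assms by (intro Ae_nonnegI[of _ "norm x"] le_infI inf.cobounded2) simp_all
  have nn: "0 \<le> x - p"
    unfolding p_def ord.diff_ge_0_iff_ge by (rule inf.cobounded1)
  \<comment> \<open>Truncating one unit higher, at (||x|| + 1) e, gives nothing beyond p; so the
    remainder x - p has no part left below e.\<close>
  have "inf (x - p) 1 + p = inf x (1 + p)"
    by (simp add: ord.add_inf_distrib_right)
  also have "\<dots> \<le> inf x ((norm x + 1) *\<^sub>R 1)"
  proof (rule inf_mono[OF order_refl])
    have "1 + p \<le> 1 + norm x *\<^sub>R 1"
      unfolding p_def by (intro ord.add_left_mono inf.cobounded2)
    then show "1 + p \<le> (norm x + 1) *\<^sub>R 1" by (simp add: scaleR_add_left add.commute)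
  qed
  also have "\<dots> \<le> p"
    unfolding p_def by (intro le_infI inf.cobounded1 inf_scaleR_one_le_norm) simp
  finally have "inf (x - p) 1 \<le> 0" by (simp only: ord.add_le_same_cancel2)
  with nn one_nonneg have "inf (x - p) 1 = 0" by (intro antisym le_infI)
  then have "x - p \<in> disj_compl Ae" by (simp only: mem_disj_compl_Ae_iff ord.abs_of_nonneg[OF nn])
  then show "x - inf x (norm x *\<^sub>R 1) \<in> disj_compl Ae" by (simp only: p_def)
qed

lemma Ae_decomposition:
  fixes x :: 'a
  obtains p q where "p \<in> Ae" "q \<in> disj_compl Ae" "x = p + q"
proof -
  define u where "u = sup x 0"
  define v where "v = u - x"
  have "0 \<le> u" unfolding u_def by (rule sup.cobounded2)
  moreover have "0 \<le> v"
    unfolding v_def u_def ord.diff_ge_0_iff_ge by (rule sup.cobounded1)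
  ultimately obtain p q where
    "p \<in> Ae" "u - p \<in> disj_compl Ae" "q \<in> Ae" "v - q \<in> disj_compl Ae"
    using Ae_decomposition_nonneg by blast
  then have "p - q \<in> Ae" "(u - p) - (v - q) \<in> disj_compl Ae"
    by (simp_all only: Ae_diff disj_compl_Ae_diff)
  then show ?thesis by (rule that) (simp add: v_def)
qed

lemma Ae_decomposition_unique:
  "\<exists>!p. fst p \<in> Ae \<and> snd p \<in> disj_compl Ae \<and> (x :: 'a) = fst p + snd p"
proof -
  obtain p q where pq: "p \<in> Ae" "q \<in> disj_compl Ae" "x = p + q" by (rule Ae_decomposition)
  show ?thesis
  proof (rule ex1I[of _ "(p, q)"])
    fix r assume r: "fst r \<in> Ae \<and> snd r \<in> disj_compl Ae \<and> x = fst r + snd r"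
    then have eq: "fst r - p = q - snd r" using pq(3) by (simp add: algebra_simps)
    have "fst r - p \<in> Ae" using r pq by (simp only: Ae_diff)
    moreover have "fst r - p \<in> disj_compl Ae"
      unfolding eq using r pq by (simp only: disj_compl_Ae_diff)
    ultimately have "fst r - p = 0" by (rule Ae_Int_disj_compl)
    with eq show "r = (p, q)" by (simp add: prod_eq_iff)
  qed (use pq in simp)
qed

text \<open>Split s = p + q. For c in D, the element c - p of A_e lies below q, which is disjoint
  from it; so p already bounds D and q \<le> 0. Comparing with one element d of D gives q \<ge>
  0.\<close>

lemma band_Ae: "band (Ae :: 'a set)"
  unfolding band_def
proof (intro conjI allI impI order_ideal_Ae)
  fix D and s :: 'a
  assume "D \<subseteq> Ae \<and> is_sup_of D s"
  then have D: "D \<subseteq> Ae" and s: "is_sup_of D s" by simp_all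
  have ub: "d \<le> s" if "d \<in> D" for d
    using s that unfolding is_sup_of_def by simp
  have lub: "s \<le> u" if "\<And>d. d \<in> D \<Longrightarrow> d \<le> u" for u
    using s that unfolding is_sup_of_def by simp
  \<comment> \<open>The definition of a band admits the empty set; its supremum would be a least
    element, contradicted by s - e.\<close>
  have "D \<noteq> {}"
  proof
    assume "D = {}"
    then have "s \<le> s - 1" by (intro lub) simp
    then have "1 \<le> (0 :: 'a)" by (simp add: ord.le_diff_eq)
    then show False using scaleR_one_le_0_iff[of 1] by simp
  qed
  then obtain d where d: "d \<in> D" by blast
  obtain p q where pq: "p \<in> Ae" "q \<in> disj_compl Ae" "s = p + q" by (rule Ae_decomposition)
  have le: "c - p \<le> q" if "c \<in> D" for c
    using ub[OF that] unfolding pq(3) by (simp only: ord.diff_le_eq add.commute)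
  have "s \<le> p"
  proof (rule lub)
    fix c assume c: "c \<in> D"
    have "c - p \<le> 0"
    proof (rule le_0_of_disjoint_bounds)
      show "c - p \<in> Ae" using c D pq by (intro Ae_diff) auto
      show "q \<in> disj_compl Ae" by (fact pq)
      show "c - p \<le> lat_abs (c - p)" by (rule ord.abs_ge_self)
      show "c - p \<le> lat_abs q" using le[OF c] ord.abs_ge_self by (rule order_trans)
    qed
    then show "c \<le> p" by (simp only: ord.diff_le_0_iff_le)
  qed
  then have "q \<le> 0" by (simp add: pq(3))
  moreover have "0 \<le> q"
    unfolding ord.neg_le_0_iff_le[of q, symmetric]
  proof (rule le_0_of_disjoint_bounds)
    show "d - p \<in> Ae" using d D pq by (intro Ae_diff) auto
    show "q \<in> disj_compl Ae" by (fact pq)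
    have "- q \<le> - (d - p)" using le[OF d] by (simp only: ord.neg_le_iff_le)
    then show "- q \<le> lat_abs (d - p)" using ord.abs_ge_minus_self by (rule order_trans)
    show "- q \<le> lat_abs q" by (rule ord.abs_ge_minus_self)
  qed
  ultimately have "q = 0" by (rule antisym)
  with pq show "s \<in> Ae" by simp
qed

section \<open>Inverses of elements of A_e\<close>

lemma Ae_mult_disj_compl:
  fixes a q :: 'a
  assumes "a \<in> Ae" "q \<in> disj_compl Ae"
  shows "a * q \<in> disj_compl Ae"
proof -
  obtain t where t: "0 \<le> t" "lat_abs a \<le> t *\<^sub>R 1" using assms(1) by (rule AeE)
  \<comment> \<open>Multiplication by a keeps q within a multiple of |q|, and such elements stay
    disjoint from e.\<close>
  have "lat_abs (a * q) \<le> lat_abs a * lat_abs q" by (rule lat_abs_mult_le)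
  also have "\<dots> \<le> t *\<^sub>R lat_abs q"
    using ord.mult_right_mono[OF t(2), of "lat_abs q"] by simp
  finally have le: "lat_abs (a * q) \<le> t *\<^sub>R lat_abs q" .
  have "inf (t *\<^sub>R lat_abs q) (1 *\<^sub>R 1) = 0"
    using assms(2) t by (simp only: inf_scaleR_eq_0 mem_disj_compl_Ae_iff zero_le_one)
  then show ?thesis
    unfolding mem_disj_compl_Ae_iff
    by (rule inf_eq_0_mono) (simp_all add: le one_nonneg)
qed

lemma Ae_inverse_closed:
  fixes a b :: 'a
  assumes "a \<in> Ae" "a * b = 1" "b * a = 1"
  shows "b \<in> Ae"
proof -
  obtain p q where pq: "p \<in> Ae" "q \<in> disj_compl Ae" "b = p + q" by (rule Ae_decomposition)
  have "a * q = 1 - a * p" using assms(2) by (simp add: pq(3) distrib_left algebra_simps)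
  then have "a * q \<in> Ae" using assms(1) pq(1) by (simp only: Ae_diff Ae_mult one_in_Ae)
  then have "a * q = 0" using Ae_mult_disj_compl[OF assms(1) pq(2)] by (rule Ae_Int_disj_compl)
  then have "q = 0" by (metis assms(3) mult.assoc mult_1_left mult_zero_right)
  with pq show ?thesis by simp
qed

section \<open>Lattice homomorphisms below a given functional\<close>

lemma lattice_hom_inf: "lattice_hom \<phi> \<Longrightarrow> \<phi> (inf x y) = min (\<phi> x) (\<phi> (y :: 'a))"
  by (simp only: ord.inf_eq_neg_sup lattice_hom_sup lattice_hom_minus minus_max_eq_min minus_minus)

text \<open>In the model this replaces \<open>F\<close> by the set of points of \<open>F\<close> at which \<open>x\<close> is maximal.\<close>

lemma sup_sublinear_cut:
  fixes p :: "'a \<Rightarrow> real"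
  assumes p: "sup_sublinear p"
  obtains q where "sup_sublinear q" "\<And>y. q y \<le> p y" "q (- x) \<le> - p x"
proof -
  \<comment> \<open>In the model, max (y + s x) - s max x decreases, as s grows, to the maximum of y
    over the points where x is maximal.\<close>
  define f where "f s y = p (y + s *\<^sub>R x) - s * p x" for s y
  define q where "q y = (INF g\<in>f ` {0..}. g y)" for y
  have f_ge: "- p (- y) \<le> f s y" if "0 \<le> s" for s y
    using sup_sublinear_add[OF p, of "y + s *\<^sub>R x" "- y"] sup_sublinear_scaleR[OF p that, of x]
    by (simp add: f_def)
  have bdd: "bdd_below ((\<lambda>g. g y) ` f ` {0..})" for y
    by (rule bdd_belowI[of _ "- p (- y)"]) (auto simp: f_ge)
  have anti: "f t y \<le> f s y" if "s \<le> t" for s t y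
    using sup_sublinear_add[OF p, of "y + s *\<^sub>R x" "(t - s) *\<^sub>R x"]
      sup_sublinear_scaleR[OF p, of "t - s" x] that
    by (simp add: f_def algebra_simps)
  have "sup_sublinear q"
    unfolding q_def
  proof (rule sup_sublinear_INF)
    fix g h assume "g \<in> f ` {0..}" "h \<in> f ` {0..}"
    then obtain s t where st: "0 \<le> s" "g = f s" "0 \<le> t" "h = f t" by auto
    have "f (s + t) (y + z) \<le> f s y + f t z" for y z
      using sup_sublinear_add[OF p, of "y + s *\<^sub>R x" "z + t *\<^sub>R x"]
      by (simp add: f_def algebra_simps)
    with st show "\<exists>k\<in>f ` {0..}. \<forall>y z. k (y + z) \<le> g y + h z"
      by (intro bexI[of _ "f (s + t)"]) auto
    show "\<exists>k\<in>f ` {0..}. \<forall>y. k y \<le> g y \<and> k y \<le> h y"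
      using st by (intro bexI[of _ "f (max s t)"]) (auto intro: anti)
  next
    fix g and c :: real assume "g \<in> f ` {0..}" and c: "0 \<le> c"
    then obtain s where s: "0 \<le> s" "g = f s" by auto
    have "f (c * s) (c *\<^sub>R y) = c * f s y" for y
      using sup_sublinear_scaleR[OF p c, of "y + s *\<^sub>R x"]
      by (simp add: f_def algebra_simps)
    with s c show "\<exists>k\<in>f ` {0..}. \<forall>y. k (c *\<^sub>R y) \<le> c * g y"
      by (intro bexI[of _ "f (c * s)"]) auto
  next
    fix g y z assume "g \<in> f ` {0..}"
    then show "g (sup y z) = max (g y) (g z)"
      by (auto simp: f_def ord.add_sup_distrib_right sup_sublinear_sup[OF p])
  qed (use bdd in auto)
  moreover have lower: "q y \<le> f s y" if "0 \<le> s" for s y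
    unfolding q_def using that by (intro cINF_lower[OF bdd]) simp
  moreover have "q y \<le> p y" for y
    using lower[of 0 y] by (simp add: f_def)
  moreover have "q (- x) \<le> - p x"
    using lower[of 1 "- x"] sup_sublinear_0[OF p] by (simp add: f_def)
  ultimately show ?thesis using that by blast
qed

text \<open>Let m be minimal below p. Cutting m at x yields a functional below m, hence m itself, so
  m (-x) \<le> - m x; with subadditivity this makes m odd, and then additive and
  homogeneous.\<close>

lemma lattice_hom_below:
  fixes p :: "'a \<Rightarrow> real"
  assumes p: "sup_sublinear p"
  obtains \<phi> where "lattice_hom \<phi>" "\<And>x. \<phi> x \<le> p x"
proof -
  define S where "S = {q. sup_sublinear q \<and> q \<le> p}"
  have "\<exists>m\<in>S. \<forall>q\<in>S. q \<le> m \<longrightarrow> q = m"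
  proof (rule predicate_Zorn)
    \<comment> \<open>Zorn's lemma is applied to the reversed order, so chains need lower bounds;
      these are pointwise infima.\<close>
    show "partial_order_on S (relation_of (\<lambda>q r. r \<le> q) S)"
      by (rule partial_order_on_relation_ofI) auto
    fix C assume "C \<in> Chains (relation_of (\<lambda>q r. r \<le> q) S)"
    then have CS: "q \<in> S" and chain: "r \<in> C \<Longrightarrow> r \<le> q \<or> q \<le> r" if "q \<in> C" for q r
      using that by (auto simp: Chains_def relation_of_def)
    show "\<exists>u\<in>S. \<forall>q\<in>C. u \<le> q"
    proof (cases "C = {}")
      case True
      then show ?thesis using p by (auto simp: S_def)
    next
      case False
      have sub: "sup_sublinear q" and le: "q x \<le> p x" if "q \<in> C" for q x
        using CS[OF that] by (auto simp: S_def le_fun_def)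
      \<comment> \<open>The estimate q x \<ge> - q (-x) \<ge> - p (-x) keeps the infima
        finite.\<close>
      have bdd: "bdd_below ((\<lambda>q. q x) ` C)" for x
        using sup_sublinear_minus_le[OF sub, of _ x] le[of _ "- x"]
        by (intro bdd_belowI[of _ "- p (- x)"]) force
      define u where "u x = (INF q\<in>C. q x)" for x
      have lower: "u \<le> q" if "q \<in> C" for q
        unfolding u_def le_fun_def using that by (auto intro: cINF_lower bdd)
      have "sup_sublinear u"
        unfolding u_def
      proof (rule sup_sublinear_INF[OF False bdd])
        fix g h assume gh: "g \<in> C" "h \<in> C"
        then obtain k where k: "k \<in> C" "k \<le> g" "k \<le> h" using chain by blast
        then show "\<exists>k\<in>C. \<forall>x. k x \<le> g x \<and> k x \<le> h x" by (auto simp: le_fun_def)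
        have "k (x + y) \<le> g x + h y" for x y
          using sup_sublinear_add[OF sub[OF k(1)], of x y] add_mono[OF k(2,3)[THEN le_funD]]
          by (rule order_trans)
        then show "\<exists>k\<in>C. \<forall>x y. k (x + y) \<le> g x + h y" using k(1) by auto
      next
        fix g and c :: real assume "g \<in> C" "0 \<le> c"
        then show "\<exists>k\<in>C. \<forall>x. k (c *\<^sub>R x) \<le> c * g x"
          by (intro bexI[of _ g] allI sup_sublinear_scaleR_le sub)
      next
        fix g x y assume "g \<in> C"
        then show "g (sup x y) = max (g x) (g y)" by (intro sup_sublinear_sup sub)
      qed
      moreover have "u \<le> p"
      proof -
        obtain q where "q \<in> C" using False by auto
        then show ?thesis using order_trans[OF lower[of q]] CS[of q] by (simp add: S_def)
      qed
      ultimately show ?thesis using lower by (auto simp: S_def)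
    qed
  qed
  then obtain m where "m \<in> S" and m_min: "\<And>q. q \<in> S \<Longrightarrow> q \<le> m \<Longrightarrow> q = m" by blast
  then have m: "sup_sublinear m" "m \<le> p" by (simp_all add: S_def)
  have min: "q = m" if "sup_sublinear q" "q \<le> m" for q
    using m_min[of q] that order_trans[OF that(2) m(2)] by (simp add: S_def)
  have neg: "m (- x) = - m x" for x
  proof (rule antisym)
    obtain q where "sup_sublinear q" "\<And>y. q y \<le> m y" and q: "q (- x) \<le> - m x"
      using sup_sublinear_cut[OF m(1), of x] by blast
    then have "q = m" by (intro min) (simp_all add: le_fun_def)
    with q show "m (- x) \<le> - m x" by simp
    show "- m x \<le> m (- x)" using sup_sublinear_minus_le[OF m(1), of "- x"] by simp
  qed
  have "m (x + y) = m x + m y" for x y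
    using sup_sublinear_add[OF m(1), of x y] sup_sublinear_add[OF m(1), of "x + y" "- y"] neg[of y]
    by simp
  moreover have "m (c *\<^sub>R x) = c * m x" for c x
  proof (cases "0 \<le> c")
    case False
    then show ?thesis using sup_sublinear_scaleR[OF m(1), of "- c" x] neg[of "c *\<^sub>R x"] by simp
  qed (rule sup_sublinear_scaleR[OF m(1)])
  ultimately have "lattice_hom m"
    using m(1) by (simp add: lattice_hom_def sup_sublinear_sup)
  with m(2) show ?thesis by (intro that) (auto simp: le_fun_def)
qed

section \<open>The functional \<open>top_value\<close>\<close>

lemma inf_sup_distrib_le: "inf (sup x y) z \<le> sup (inf x z) (inf y (z :: 'a))"
proof -
  define b where "b = sup (inf x z) (inf y z)"
  define u where "u = sup x y"
  \<comment> \<open>Distributivity rests on v + z = inf v z + sup v z: the bound for v = x and v = y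
    passes to the supremum, and sup u z cancels.\<close>
  have le: "v + z \<le> b + sup u z" if "inf v z \<le> b" "v \<le> u" for v
  proof -
    have "v + z = inf v z + sup v z" by (simp only: ord.add_eq_inf_sup[of v z] add.commute)
    also have "\<dots> \<le> b + sup u z" using that by (intro ord.add_mono sup_mono order_refl)
    finally show ?thesis .
  qed
  have "x + z \<le> b + sup u z" "y + z \<le> b + sup u z"
    by (rule le; simp add: b_def u_def)+
  then have "sup x y + z \<le> b + sup u z" by (simp only: ord.add_sup_distrib_right le_supI)
  then have "inf u z + sup u z \<le> b + sup u z"
    using ord.add_eq_inf_sup[of u z] by (simp only: u_def[symmetric] add.commute)
  then show ?thesis by (simp only: ord.add_le_cancel_right b_def u_def)
qed

text \<open>The condition \<open>inf v 1 \<le> 0\<close> says that the positive part of v is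
  disjoint from e. Distributivity allows replacing x and y by their positive parts, to which
  \<open>inf_add_le_0\<close> applies.\<close>

lemma inf_one_add_le_0:
  fixes x y :: 'a
  assumes "inf x 1 \<le> 0" "inf y 1 \<le> 0"
  shows "inf (x + y) 1 \<le> 0"
proof -
  have pos: "inf (sup v 0) 1 \<le> 0" if "inf v 1 \<le> 0" for v :: 'a
    using inf_sup_distrib_le[of v 0 1] le_supI[OF that inf.cobounded1[of 0 1]]
    by (rule order_trans)
  have "inf (x + y) 1 \<le> inf (sup x 0 + sup y 0) 1"
    by (intro inf_mono ord.add_mono sup.cobounded1 order_refl)
  also have "\<dots> \<le> 0"
    by (intro inf_add_le_0 pos assms sup.cobounded2)
  finally show ?thesis .
qed

text \<open>In the representation on \<open>C(K)\<close>, \<open>top_value x\<close> is the maximum of (the band component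
  of) \<open>x\<close> over \<open>K\<close>.\<close>

definition upper_levels :: "'a \<Rightarrow> real set" where
  "upper_levels x = {t. inf (x - t *\<^sub>R 1) 1 \<le> 0}"

definition top_value :: "'a \<Rightarrow> real" where
  "top_value x = Inf (upper_levels x)"

lemma norm_in_upper_levels: "norm x \<in> upper_levels x"
proof -
  \<comment> \<open>Translation by ||x|| e turns the claim into the truncation bound at (||x|| + 1)
    e.\<close>
  have "inf (x - norm x *\<^sub>R 1) 1 + norm x *\<^sub>R 1 = inf x ((norm x + 1) *\<^sub>R 1)"
    by (simp only: ord.add_inf_distrib_right scaleR_add_left scaleR_one diff_add_cancel)
      (simp only: add.commute)
  also have "\<dots> \<le> norm x *\<^sub>R 1"
    by (rule inf_scaleR_one_le_norm) simp
  finally show ?thesis by (simp only: upper_levels_def mem_Collect_eq ord.add_le_same_cancel2)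
qed

lemma upper_levels_add:
  "s \<in> upper_levels x \<Longrightarrow> t \<in> upper_levels y \<Longrightarrow> s + t \<in> upper_levels (x + y)"
  using inf_one_add_le_0[of "x - s *\<^sub>R 1" "y - t *\<^sub>R 1"]
  by (simp only: upper_levels_def mem_Collect_eq scaleR_add_left add_diff_add)

lemma upper_levels_zero_nonneg:
  assumes "t \<in> upper_levels 0"
  shows "0 \<le> t"
proof (rule ccontr)
  assume "\<not> 0 \<le> t"
  then have "min (- t) 1 *\<^sub>R 1 \<le> inf ((- t) *\<^sub>R 1) (1 *\<^sub>R (1 :: 'a))"
    by (intro le_infI; simp only: scaleR_one_le_iff; simp)
  also have "\<dots> \<le> 0"
    using assms by (simp add: upper_levels_def)
  finally have "min (- t) 1 \<le> 0" by (simp only: scaleR_one_le_0_iff)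
  with \<open>\<not> 0 \<le> t\<close> show False by simp
qed

text \<open>The number t + ||x|| is a level of x + (-x) = 0 and therefore nonnegative.\<close>

lemma upper_levels_ge: "t \<in> upper_levels x \<Longrightarrow> - norm x \<le> t"
  using upper_levels_zero_nonneg[of "t + norm x"] upper_levels_add[of t x "norm x" "- x"]
    norm_in_upper_levels[of "- x"] by simp

lemma bdd_below_upper_levels: "bdd_below (upper_levels x)"
  using upper_levels_ge by (rule bdd_belowI)

lemma upper_levels_mono:
  assumes "t \<in> upper_levels x" "y \<le> x" "t \<le> s"
  shows "s \<in> upper_levels y"
proof -
  have "y - s *\<^sub>R 1 \<le> x - t *\<^sub>R 1"
    using assms(2,3) by (intro ord.diff_mono) (simp_all only: scaleR_one_le_iff)
  then have "inf (y - s *\<^sub>R 1) 1 \<le> inf (x - t *\<^sub>R 1) 1" by (rule inf_mono[OF _ order_refl])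
  with assms(1) show ?thesis
    unfolding upper_levels_def mem_Collect_eq by (meson order_trans)
qed

lemma top_value_le: "t \<in> upper_levels x \<Longrightarrow> top_value x \<le> t"
  unfolding top_value_def by (rule cInf_lower[OF _ bdd_below_upper_levels])

lemma top_value_ge: "(\<And>t. t \<in> upper_levels x \<Longrightarrow> b \<le> t) \<Longrightarrow> b \<le> top_value x"
  unfolding top_value_def using norm_in_upper_levels by (intro cInf_greatest) auto

lemma top_value_less:
  assumes "top_value x < t" shows "t \<in> upper_levels x"
proof -
  obtain s where "s \<in> upper_levels x" "s < t"
    using assms norm_in_upper_levels cInf_lessD[of "upper_levels x" t] unfolding top_value_def by auto
  then show ?thesis using upper_levels_mono[of s x x t] by simp
qed

lemma upper_levels_sup:
  assumes "t \<in> upper_levels x" "t \<in> upper_levels y"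
  shows "t \<in> upper_levels (sup x y)"
proof -
  have "inf (sup x y - t *\<^sub>R 1) 1 = inf (sup (x - t *\<^sub>R 1) (y - t *\<^sub>R 1)) 1"
    by (simp only: diff_conv_add_uminus ord.add_sup_distrib_right)
  also have "\<dots> \<le> sup (inf (x - t *\<^sub>R 1) 1) (inf (y - t *\<^sub>R 1) 1)"
    by (rule inf_sup_distrib_le)
  also have "\<dots> \<le> 0" using assms by (intro le_supI) (simp_all only: upper_levels_def mem_Collect_eq)
  finally show ?thesis by (simp only: upper_levels_def mem_Collect_eq)
qed

lemma upper_levels_scaleR:
  assumes "0 < c" "t \<in> upper_levels x"
  shows "c * t \<in> upper_levels (c *\<^sub>R x)"
proof -
  define d where "d = x - t *\<^sub>R 1"
  have d: "inf d 1 \<le> 0" using assms(2) by (simp only: upper_levels_def mem_Collect_eq d_def)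
  \<comment> \<open>For the positive part the inequality becomes exact disjointness from e, so d'
    can be rescaled while e stays fixed.\<close>
  define d' where "d' = sup d 0"
  have "inf d' 1 \<le> sup (inf d 1) (inf 0 1)"
    unfolding d'_def by (rule inf_sup_distrib_le)
  also have "\<dots> \<le> 0" using d by (intro le_supI inf.cobounded1)
  finally have "inf d' 1 = 0"
    using one_nonneg by (intro antisym le_infI) (simp_all only: d'_def sup.cobounded2)
  then have "inf (c *\<^sub>R d') (1 *\<^sub>R 1) = 0"
    using assms(1) by (intro inf_scaleR_eq_0) simp_all
  moreover have "c *\<^sub>R d \<le> c *\<^sub>R d'"
    unfolding d'_def using assms(1) by (intro ord.scaleR_left_mono sup.cobounded1) simp
  ultimately have "inf (c *\<^sub>R d) 1 \<le> 0"
    using inf_mono[of "c *\<^sub>R d" "c *\<^sub>R d'" 1 1] by simp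
  then show ?thesis
    by (simp only: upper_levels_def mem_Collect_eq d_def scaleR_diff_right scaleR_scaleR)
qed

text \<open>This supplies the functional from which the characters are built: levels add, scale, and
  are stable under suprema.\<close>

lemma sup_sublinear_top_value: "sup_sublinear top_value"
  unfolding sup_sublinear_def
proof (intro conjI allI impI)
  fix x y :: 'a
  show "top_value (x + y) \<le> top_value x + top_value y"
  proof -
    have "top_value (x + y) - s \<le> t" if "s \<in> upper_levels x" "t \<in> upper_levels y" for s t
      using top_value_le[OF upper_levels_add[OF that]] by simp
    then have "top_value (x + y) - s \<le> top_value y" if "s \<in> upper_levels x" for s
      using that by (intro top_value_ge)
    then have "top_value (x + y) - top_value y \<le> top_value x"
      by (intro top_value_ge) (simp add: algebra_simps)
    then show ?thesis by simp
  qed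
  show "top_value (c *\<^sub>R x) \<le> c * top_value x" if "0 \<le> c" for c
  proof (cases "c = 0")
    case True
    then show ?thesis using top_value_le[OF norm_in_upper_levels[of 0]] by simp
  next
    case False
    with that have c: "0 < c" by simp
    have "top_value (c *\<^sub>R x) / c \<le> top_value x"
      using top_value_le[OF upper_levels_scaleR[OF c]] c
      by (intro top_value_ge) (simp add: field_simps)
    with c show ?thesis by (simp add: field_simps)
  qed
  show "top_value (sup x y) = max (top_value x) (top_value y)"
  proof (rule antisym)
    show "top_value (sup x y) \<le> max (top_value x) (top_value y)"
      by (rule dense_ge) (intro top_value_le upper_levels_sup top_value_less; simp)
    show "max (top_value x) (top_value y) \<le> top_value (sup x y)"
      by (intro max.boundedI top_value_ge top_value_le)
        (erule upper_levels_mono; simp only: sup.cobounded1 sup.cobounded2 order_refl)+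
  qed
qed

text \<open>For a level t, the positive part of x - t e is disjoint from A_e and also belongs to it,
  so it vanishes and x \<le> t e.\<close>

lemma norm_le_top_value:
  fixes x :: 'a
  assumes "x \<in> Ae" "0 \<le> x"
  shows "norm x \<le> top_value x"
proof (rule top_value_ge)
  fix t assume "t \<in> upper_levels x"
  then have "inf (x - t *\<^sub>R 1) 1 \<le> 0" by (simp only: upper_levels_def mem_Collect_eq)
  then have "sup (inf (x - t *\<^sub>R 1) 1) (inf 0 1) \<le> 0" by (intro le_supI inf.cobounded1)
  with inf_sup_distrib_le have "inf (sup (x - t *\<^sub>R 1) 0) 1 \<le> 0" by (rule order_trans)
  then have "inf (sup (x - t *\<^sub>R 1) 0) 1 = 0"
    using one_nonneg by (intro antisym le_infI) (simp_all only: sup.cobounded2)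
  then have "sup (x - t *\<^sub>R 1) 0 \<in> disj_compl Ae"
    by (simp only: mem_disj_compl_Ae_iff ord.abs_of_nonneg sup.cobounded2)
  moreover have "sup (x - t *\<^sub>R 1) 0 \<in> Ae"
    using assms by (intro Ae_sup Ae_diff Ae_scaleR one_in_Ae zero_in_Ae)
  ultimately have "sup (x - t *\<^sub>R 1) 0 = 0" by (rule Ae_Int_disj_compl[rotated])
  then have "x - t *\<^sub>R 1 \<le> 0" by (metis sup.cobounded1)
  then have "x \<le> t *\<^sub>R 1" by (simp only: ord.diff_le_0_iff_le)
  then show "norm x \<le> t"
    using assms(2) by (intro norm_le_of_lat_abs_le_scaleR) (simp only: ord.abs_of_nonneg)
qed

section \<open>Characters and the representation on C(K)\<close>

definition characters :: "('a \<Rightarrow> real) set" where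
  "characters = {\<phi>. lattice_hom \<phi> \<and> \<phi> 1 = 1}"

lemma abs_character_le_norm:
  assumes "\<phi> \<in> characters"
  shows "\<bar>\<phi> x\<bar> \<le> norm x"
proof -
  have hom: "lattice_hom \<phi>" and one: "\<phi> 1 = 1" using assms by (simp_all add: characters_def)
  have "\<phi> y \<le> norm y" for y
  proof -
    \<comment> \<open>Truncating strictly above the norm ensures that the resulting minimum can only
      be \<phi> y.\<close>
    have "\<phi> (inf y ((norm y + 1) *\<^sub>R 1)) \<le> \<phi> (norm y *\<^sub>R 1)"
      by (intro lattice_hom_mono[OF hom] inf_scaleR_one_le_norm) simp
    then have "min (\<phi> y) (norm y + 1) \<le> norm y"
      by (simp add: lattice_hom_inf[OF hom] lattice_hom_scaleR[OF hom] one)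
    then show ?thesis by simp
  qed
  from this[of x] this[of "- x"] show ?thesis by (simp add: lattice_hom_minus[OF hom])
qed

text \<open>Cutting \<open>top_value\<close> at |x| forces every homomorphism below to be at least
  the top value of |x| there. The value at e is pinned from both sides, since
  \<open>top_value\<close> is at most 1 at e and at most -1 at -e.\<close>

lemma norming_character:
  fixes x :: 'a
  assumes "x \<in> Ae"
  obtains \<phi> where "\<phi> \<in> characters" "\<bar>\<phi> x\<bar> = norm x"
proof -
  obtain q where q: "sup_sublinear q" "\<And>y. q y \<le> top_value y"
    "q (- lat_abs x) \<le> - top_value (lat_abs x)"
    using sup_sublinear_cut[OF sup_sublinear_top_value, of "lat_abs x"] by auto
  obtain \<phi> where hom: "lattice_hom \<phi>" and le: "\<And>y. \<phi> y \<le> q y"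
    using lattice_hom_below[OF q(1)] by auto
  have "\<phi> 1 \<le> 1"
    using le[of 1] q(2)[of 1] top_value_le[OF norm_in_upper_levels[of 1]] by simp
  moreover have "- 1 \<in> upper_levels (- 1)"
    by (simp add: upper_levels_def)
  then have "\<phi> (- 1) \<le> - 1"
    using le[of "- 1"] q(2)[of "- 1"] top_value_le[of "- 1" "- 1"] by simp
  ultimately have "\<phi> 1 = 1" by (simp add: lattice_hom_minus[OF hom])
  with hom have char: "\<phi> \<in> characters" by (simp add: characters_def)
  have "norm x \<le> top_value (lat_abs x)"
    using norm_le_top_value[OF lat_abs_in_Ae[OF assms] ord.abs_ge_zero] by simp
  also have "\<dots> \<le> - \<phi> (- lat_abs x)"
    using q(3) le[of "- lat_abs x"] by simp
  also have "\<dots> = \<bar>\<phi> x\<bar>"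
    by (simp only: lattice_hom_minus[OF hom] lattice_hom_lat_abs[OF hom] minus_minus)
  finally have "norm x \<le> \<bar>\<phi> x\<bar>" .
  with abs_character_le_norm[OF char, of x] have "\<bar>\<phi> x\<bar> = norm x" by simp
  with char show ?thesis by (rule that)
qed

lemma character_mult:
  assumes "\<phi> \<in> characters" "y \<in> Ae"
  shows "\<phi> (x * y) = \<phi> x * \<phi> y"
proof -
  have hom: "lattice_hom \<phi>" and one: "\<phi> 1 = 1" using assms by (simp_all add: characters_def)
  have bound: "\<bar>\<phi> (z * y)\<bar> \<le> norm y * \<bar>\<phi> z\<bar>" for z
  proof -
    have "lat_abs (z * y) \<le> lat_abs z * lat_abs y" by (rule lat_abs_mult_le)
    also have "\<dots> \<le> lat_abs z * norm y *\<^sub>R 1"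
      using lat_abs_le_norm[OF assms(2)] by (intro ord.mult_left_mono ord.abs_ge_zero)
    finally have "\<phi> (lat_abs (z * y)) \<le> \<phi> (norm y *\<^sub>R lat_abs z)"
      by (intro lattice_hom_mono[OF hom]) simp
    then show ?thesis
      by (simp add: lattice_hom_lat_abs[OF hom] lattice_hom_scaleR[OF hom])
  qed
  \<comment> \<open>Subtracting \<phi>(x) e moves x into the kernel, which by \<open>bound\<close>
    is stable under right multiplication by y.\<close>
  have "\<phi> (x - \<phi> x *\<^sub>R 1) = 0"
    by (simp add: lattice_hom_diff[OF hom] lattice_hom_scaleR[OF hom] one)
  with bound[of "x - \<phi> x *\<^sub>R 1"] have "\<phi> ((x - \<phi> x *\<^sub>R 1) * y) = 0" by simp
  then show ?thesis
    by (simp add: left_diff_distrib lattice_hom_diff[OF hom] lattice_hom_scaleR[OF hom])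
qed

lemma character_eqI:
  assumes "\<phi> \<in> characters" "\<psi> \<in> characters" "\<And>x. x \<in> Ae \<Longrightarrow> \<phi> x = \<psi> x"
  shows "\<phi> = \<psi>"
proof
  fix x :: 'a
  have vanish: "\<theta> q = 0" if "\<theta> \<in> characters" "q \<in> disj_compl Ae" for \<theta> q
  proof -
    have hom: "lattice_hom \<theta>" and one: "\<theta> 1 = 1" using that by (simp_all add: characters_def)
    \<comment> \<open>On the disjoint complement min |\<theta> q| 1 = 0, which leaves only \<theta>
      q = 0.\<close>
    have "0 = \<theta> (inf (lat_abs q) 1)"
      using that(2) lattice_hom_scaleR[OF hom, of 0 0] by (simp only: mem_disj_compl_Ae_iff) simp
    then show ?thesis
      by (simp add: lattice_hom_inf[OF hom] lattice_hom_lat_abs[OF hom] one min_def split: if_splits)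
  qed
  obtain p q where pq: "p \<in> Ae" "q \<in> disj_compl Ae" "x = p + q" by (rule Ae_decomposition)
  have hom: "lattice_hom \<phi>" "lattice_hom \<psi>" using assms by (simp_all add: characters_def)
  show "\<phi> x = \<psi> x"
    by (simp only: pq(3) lattice_hom_add[OF hom(1)] lattice_hom_add[OF hom(2)]
        vanish[OF assms(1) pq(2)] vanish[OF assms(2) pq(2)] assms(3)[OF pq(1)])
qed

text \<open>The defining equations are closed conditions on coordinates, and the norm bound places
  the characters in a product of compact intervals, to which Tychonoff's theorem applies.\<close>

lemma compact_characters: "compact characters"
proof -
  let ?B = "PiE UNIV (\<lambda>x :: 'a. {- norm x..norm x})"
  have "compactin (product_topology (\<lambda>_. euclideanreal) UNIV) ?B"
    by (simp add: compactin_PiE)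
  then have "compact ?B"
    by (simp add: euclidean_product_topology)
  moreover have "closed characters"
    unfolding characters_def lattice_hom_def
    by (intro closed_Collect_conj closed_Collect_all closed_Collect_eq continuous_intros
        continuous_on_product_coordinates)
  moreover have "characters \<subseteq> ?B"
  proof (intro subsetI PiE_I)
    fix \<phi> x assume "\<phi> \<in> characters"
    then show "\<phi> x \<in> {- norm x..norm x}"
      using abs_character_le_norm[of \<phi> x] by (simp add: abs_le_iff)
  qed simp
  ultimately show ?thesis by (metis compact_Int_closed inf.absorb2)
qed

lemma continuous_function_represented:
  assumes f: "continuous_on characters f"
  obtains x where "x \<in> Ae" "\<And>\<phi>. \<phi> \<in> characters \<Longrightarrow> f \<phi> = \<phi> x"
proof -
  define P where "P g \<longleftrightarrow> (\<exists>x\<in>Ae. \<forall>\<phi>\<in>characters. g \<phi> = \<phi> x)" for g :: "('a \<Rightarrow> real) \<Rightarrow> real"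
  have hom: "lattice_hom \<phi>" and one: "\<phi> 1 = 1" if "\<phi> \<in> characters" for \<phi>
    using that by (simp_all add: characters_def)
  have dense: "\<exists>g. P g \<and> (\<forall>\<phi>\<in>characters. \<bar>f \<phi> - g \<phi>\<bar> < e)" if "0 < e" for e
  proof (rule Stone_Weierstrass_HOL[OF compact_characters _ _ _ _ _ f that])
    show "P (\<lambda>\<phi>. c)" for c
      unfolding P_def
      by (intro bexI[of _ "c *\<^sub>R 1"] ballI Ae_scaleR one_in_Ae) (simp add: lattice_hom_scaleR[OF hom] one)
    show "continuous_on characters g" if "P g" for g
    proof -
      from that obtain x where x: "\<forall>\<phi>\<in>characters. g \<phi> = \<phi> x" unfolding P_def by blast
      have "continuous_on characters (\<lambda>\<phi>. \<phi> x)"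
        by (rule continuous_on_subset[OF continuous_on_product_coordinates]) simp
      then show ?thesis by (rule continuous_on_eq) (use x in simp)
    qed
    show "P (\<lambda>\<phi>. g \<phi> + h \<phi>)" if "P g \<and> P h" for g h
    proof -
      from that obtain x y where "x \<in> Ae" "y \<in> Ae" "\<forall>\<phi>\<in>characters. g \<phi> = \<phi> x"
        "\<forall>\<phi>\<in>characters. h \<phi> = \<phi> y" unfolding P_def by blast
      then show ?thesis
        unfolding P_def by (intro bexI[of _ "x + y"]) (simp_all add: Ae_add lattice_hom_add[OF hom])
    qed
    show "P (\<lambda>\<phi>. g \<phi> * h \<phi>)" if "P g \<and> P h" for g h
    proof -
      from that obtain x y where "x \<in> Ae" "y \<in> Ae" "\<forall>\<phi>\<in>characters. g \<phi> = \<phi> x"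
        "\<forall>\<phi>\<in>characters. h \<phi> = \<phi> y" unfolding P_def by blast
      then show ?thesis
        unfolding P_def by (intro bexI[of _ "x * y"]) (simp_all add: Ae_mult character_mult)
    qed
    show "\<exists>g. P g \<and> g \<phi> \<noteq> g \<psi>"
      if "\<phi> \<in> characters \<and> \<psi> \<in> characters \<and> \<phi> \<noteq> \<psi>" for \<phi> \<psi>
    proof -
      from that obtain x where "x \<in> Ae" "\<phi> x \<noteq> \<psi> x" using character_eqI[of \<phi> \<psi>] by auto
      then show ?thesis unfolding P_def by (intro exI[of _ "\<lambda>\<theta>. \<theta> x"]) auto
    qed
  qed
  have "\<exists>x\<in>Ae. \<forall>\<phi>\<in>characters. \<bar>f \<phi> - \<phi> x\<bar> < inverse (real (Suc n))" for n
  proof -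
    obtain g where g: "P g" "\<forall>\<phi>\<in>characters. \<bar>f \<phi> - g \<phi>\<bar> < inverse (real (Suc n))"
      using dense[of "inverse (real (Suc n))"] by auto
    from g(1) obtain x where "x \<in> Ae" "\<forall>\<phi>\<in>characters. g \<phi> = \<phi> x" unfolding P_def by blast
    with g(2) show ?thesis by (intro bexI[of _ x]) simp_all
  qed
  then obtain X where X: "\<And>n. X n \<in> Ae"
    and approx: "\<And>n \<phi>. \<phi> \<in> characters \<Longrightarrow> \<bar>f \<phi> - \<phi> (X n)\<bar> < inverse (real (Suc n))"
    by metis
  have "Cauchy X"
  proof (rule CauchyI)
    fix e :: real assume "0 < e"
    then obtain N where N: "inverse (real (Suc N)) < e / 2" using reals_Archimedean[of "e / 2"] by auto
    have small: "\<bar>f \<phi> - \<phi> (X n)\<bar> < e / 2" if "N \<le> n" "\<phi> \<in> characters" for n \<phi>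
    proof -
      have "inverse (real (Suc n)) \<le> inverse (real (Suc N))"
        using that by (intro le_imp_inverse_le) simp_all
      with approx[OF that(2), of n] N show ?thesis by linarith
    qed
    \<comment> \<open>A norming character for the difference converts uniform closeness on K into
      closeness in norm.\<close>
    have "norm (X m - X n) < e" if mn: "N \<le> m" "N \<le> n" for m n
    proof -
      obtain \<phi> where \<phi>: "\<phi> \<in> characters" "\<bar>\<phi> (X m - X n)\<bar> = norm (X m - X n)"
        using norming_character[OF Ae_diff[OF X X]] by blast
      have "\<phi> (X m - X n) = \<phi> (X m) - \<phi> (X n)" by (rule lattice_hom_diff[OF hom[OF \<phi>(1)]])
      with \<phi>(2) small[OF mn(1) \<phi>(1)] small[OF mn(2) \<phi>(1)] show ?thesis by linarith
    qed
    then show "\<exists>M. \<forall>m\<ge>M. \<forall>n\<ge>M. norm (X m - X n) < e" by auto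
  qed
  then obtain x where x: "X \<longlonglongrightarrow> x" by (metis Cauchy_convergent_iff convergent_def)
  have "x \<in> Ae" using closed_sequentially[OF closed_Ae X x] .
  moreover have "f \<phi> = \<phi> x" if "\<phi> \<in> characters" for \<phi>
  proof (rule LIMSEQ_unique)
    have "norm (\<phi> (X n) - \<phi> x) \<le> norm (X n - x)" for n
      using abs_character_le_norm[OF that, of "X n - x"] by (simp add: lattice_hom_diff[OF hom[OF that]])
    then have "\<forall>\<^sub>F n in sequentially. norm (\<phi> (X n) - \<phi> x) \<le> norm (X n - x)"
      by (simp only: eventually_True)
    moreover have "(\<lambda>n. norm (X n - x)) \<longlonglongrightarrow> 0"
      using x by (simp add: LIM_zero tendsto_norm_zero)
    ultimately have "(\<lambda>n. \<phi> (X n) - \<phi> x) \<longlonglongrightarrow> 0" by (rule Lim_null_comparison)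
    then show "(\<lambda>n. \<phi> (X n)) \<longlonglongrightarrow> \<phi> x" by (rule LIM_zero_cancel)
    have "norm (f \<phi> - \<phi> (X n)) \<le> inverse (real (Suc n))" for n
      using approx[OF that, of n] by simp
    then have "\<forall>\<^sub>F n in sequentially. norm (f \<phi> - \<phi> (X n)) \<le> inverse (real (Suc n))"
      by (simp only: eventually_True)
    then have "(\<lambda>n. f \<phi> - \<phi> (X n)) \<longlonglongrightarrow> 0"
      using LIMSEQ_inverse_real_of_nat by (rule Lim_null_comparison)
    then show "(\<lambda>n. \<phi> (X n)) \<longlonglongrightarrow> f \<phi>"
      using tendsto_diff[OF tendsto_const[of "f \<phi>"], of "\<lambda>n. f \<phi> - \<phi> (X n)" 0] by simp
  qed
  ultimately show ?thesis by (rule that)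
qed

lemma isometric_to_CK_characters:
  "isometric_to_CK (Ae :: 'a set) norm_e (top_of_set characters) (\<lambda>x \<phi>. \<phi> x)"
proof -
  have hom: "lattice_hom \<phi>" and one: "\<phi> 1 = 1" if "\<phi> \<in> characters" for \<phi>
    using that by (simp_all add: characters_def)
  have sup_norm: "norm_e x = (SUP \<phi>\<in>characters. \<bar>\<phi> x\<bar>)" if x: "x \<in> Ae" for x
  proof -
    \<comment> \<open>The supremum is a maximum, attained at a norming character; this also rules
      out a supremum over the empty set.\<close>
    obtain \<psi> where "\<psi> \<in> characters" "\<bar>\<psi> x\<bar> = norm x" by (rule norming_character[OF x])
    then have "(SUP \<phi>\<in>characters. \<bar>\<phi> x\<bar>) = norm x"
      by (intro cSup_eq_maximum) (auto intro: abs_character_le_norm rev_image_eqI)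
    then show ?thesis by (simp add: norm_e_eq_norm[OF x])
  qed
  have cont: "continuous_on characters (\<lambda>\<phi>. \<phi> x)" for x
    by (rule continuous_on_subset[OF continuous_on_product_coordinates]) simp
  have onto: "\<exists>x\<in>Ae. \<forall>\<phi>\<in>characters. \<phi> x = f \<phi>" if "continuous_on characters f" for f
    using continuous_function_represented[OF that] by metis
  show ?thesis
    unfolding isometric_to_CK_def
    by (simp add: cont sup_norm onto one character_mult lattice_hom_add[OF hom]
        lattice_hom_scaleR[OF hom] lattice_hom_sup[OF hom] lattice_hom_inf[OF hom])
qed

end

theorem mainTheorem7:
  assumes "banach_lattice_algebra TYPE('a::{banach,real_normed_algebra_1,lattice})"
  shows "(BLA_on (Ae :: 'a set) norm_e \<and>
          (\<exists>(X :: ('a \<Rightarrow> real) topology) T. compact_space X \<and> Hausdorff_space X \<and>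
             isometric_to_CK (Ae :: 'a set) norm_e X T))
       \<and> (band (Ae :: 'a set) \<and>
          (\<forall>x::'a. \<exists>!p. fst p \<in> Ae \<and> snd p \<in> disj_compl Ae \<and> x = fst p + snd p))
       \<and> (\<forall>a b::'a. a \<in> Ae \<and> a * b = 1 \<and> b * a = 1 \<longrightarrow> b \<in> Ae)"
proof -
  interpret unital_BLA "TYPE('a)" by (rule unital_BLA.intro) (fact assms)
  have "compact_space (top_of_set (characters :: ('a \<Rightarrow> real) set))"
    using compact_characters by (simp add: compact_space_subtopology)
  \<comment> \<open>The Hausdorff property is taken from the abstract product topology, which
    \<open>euclidean_product_topology\<close> identifies with the topology of the function
    type.\<close>
  moreover have "Hausdorff_space (product_topology (\<lambda>_ :: 'a. euclideanreal) UNIV)"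
    by (simp add: Hausdorff_space_product_topology)
  then have "Hausdorff_space (top_of_set (characters :: ('a \<Rightarrow> real) set))"
    unfolding euclidean_product_topology by (rule Hausdorff_space_subtopology)
  ultimately have "\<exists>(X :: ('a \<Rightarrow> real) topology) T. compact_space X \<and> Hausdorff_space X \<and>
      isometric_to_CK (Ae :: 'a set) norm_e X T"
    using isometric_to_CK_characters by (intro exI conjI)
  then show ?thesis
    using BLA_on_Ae band_Ae Ae_decomposition_unique by (auto intro: Ae_inverse_closed)
qed

end
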